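(* Let $m,n$ be positive integers. The following two recursive rules hold, as isomorphisms of representations of $S_{nm-1}$: $$\mathrm{Res}_{S_{nm-1}}^{S_{nm}}\left(\mathrm{Ind}_{C_{m,n}}^{S_{mn}}(1)\right) \cong \mathrm{Ind}_{S_{(n-1)m} \times S_{m-1}}^{S_{nm-1}}\left(\mathrm{Ind}_{C_{m,n-1}}^{S_{m(n-1)}}(1) \otimes 1\right),$$ $$\mathrm{Res}_{S_{nm-1}}^{S_{nm}}\left(\mathrm{Ind}_{D_{m,n}}^{S_{mn}}(1)\right) \cong \mathrm{Ind}_{S_{(n-1)m}}^{S_{nm-1}}\left(\mathrm{Ind}_{D_{m,n-1}}^{S_{m(n-1)}}(1)\right).$$
   Context: All representations are over $\mathbb{C}$, and $1$ denotes the trivial representation of the relevant group. $S_k$ is the symmetric group on $\{1,\dots,k\}$ ($S_0$ is the trivial group). $S_{nm-1}\subseteq S_{nm}$ is the stabilizer of the point $nm$; $S_{(n-1)m}\subseteq S_{nm-1}$ is the subgroup permuting $\{1,\dots,(n-1)m\}$ and fixing the other points; and $S_{(n-1)m}\times S_{m-1}\subseteq S_{nm-1}$ has the first factor permuting $\{1,\dots,(n-1)m\}$ and the second permuting $\{(n-1)m+1,\dots,nm-1\}$. In the first rule, the tensor product is the external one, with $S_{m-1}$ acting trivially on the second factor. Let $C_m \subseteq S_m$ be the cyclic group generated by an $m$-cycle. The subgroups $C_{m,n}$ and $D_{m,n}$ of $S_{mn}$ are the wreath products written in the paper as $C_{m,n} = S_n \text{ wr } S_m$ and $D_{m,n} =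 S_n \text{ wr } C_m$. Concretely, divide $\{1,\dots,mn\}$ into the $n$ consecutive blocks $\{(j-1)m+1,\dots,jm\}$, $j=1,\dots,n$. Then $C_{m,n} \cong (S_m)^n\rtimes S_n$ and $D_{m,n}\cong (C_m)^n \rtimes S_n$, where the $j$-th factor of $(S_m)^n$ or $(C_m)^n$ acts on the $j$-th block (identified with $\{1,\dots,m\}$ in the order-preserving way), and $S_n$ permutes the $n$ blocks, preserving the order within blocks. For $n=0$ both groups are trivial. *)

theory Defs
  imports
    Complex_Main
    "HOL-Library.Poly_Mapping"
    "HOL-Algebra.Module"
    "HOL-Algebra.AbelCoset"
    "HOL-Algebra.Group_Action"
    "HOL-Algebra.Generated_Groups"
    "HOL-Algebra.Sym_Groups"
    "HOL-Algebra.Algebraic_Closure_Type"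
begin

section \<open>Complex representations\<close>

abbreviation complex_field :: "complex ring" where
  "complex_field \<equiv> ring_of_type_algebra"

text \<open>The ring-multiplication fields that a module record inherits carry no meaning and are
  left undefined in the modules constructed below.\<close>

record ('g, 'v) rep = "(complex, 'v) module" +
  act :: "'g \<Rightarrow> 'v \<Rightarrow> 'v"

locale representation =
  group_action G "carrier V" "act V" + module complex_field V
  for G :: "('g, 'a) monoid_scheme" (structure) and V :: "('g, 'v, 'b) rep_scheme" +
  assumes act_add: "\<lbrakk>g \<in> carrier G; v \<in> carrier V; w \<in> carrier V\<rbrakk>
      \<Longrightarrow> act V g (v \<oplus>\<^bsub>V\<^esub> w) = act V g v \<oplus>\<^bsub>V\<^esub> act V g w"
    and act_smult: "\<lbrakk>g \<in> carrier G; v \<in> carrier V\<rbrakk>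
      \<Longrightarrow> act V g (c \<odot>\<^bsub>V\<^esub> v) = c \<odot>\<^bsub>V\<^esub> act V g v"

definition rep_iso ::
  "('g, 'a) monoid_scheme \<Rightarrow> ('g, 'v, 'b) rep_scheme \<Rightarrow> ('g, 'w, 'c) rep_scheme \<Rightarrow> bool" where
  "rep_iso G V W \<longleftrightarrow> representation G V \<and> representation G W \<and>
    (\<exists>\<phi>. bij_betw \<phi> (carrier V) (carrier W) \<and>
      (\<forall>v\<in>carrier V. \<forall>w\<in>carrier V. \<phi> (v \<oplus>\<^bsub>V\<^esub> w) = \<phi> v \<oplus>\<^bsub>W\<^esub> \<phi> w) \<and>
      (\<forall>c. \<forall>v\<in>carrier V. \<phi> (c \<odot>\<^bsub>V\<^esub> v) = c \<odot>\<^bsub>W\<^esub> \<phi> v) \<and>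
      (\<forall>g\<in>carrier G. \<forall>v\<in>carrier V. \<phi> (act V g v) = act W g (\<phi> v)))"

definition triv_rep :: "('g, complex) rep" where
  "triv_rep = \<lparr>carrier = UNIV, monoid.mult = undefined, one = undefined,
     zero = 0, add = (+), module.smult = (*), act = (\<lambda>g. id)\<rparr>"

definition res_rep :: "'g set \<Rightarrow> ('g, 'v) rep \<Rightarrow> ('g, 'v) rep" where
  "res_rep H V = V\<lparr>act := restrict (act V) H\<rparr>"

text \<open>Induction from \<open>H\<close> to a finite group \<open>G\<close> along an injective homomorphism \<open>\<iota>\<close>, which is the
  identity when \<open>H\<close> is literally a subgroup of \<open>G\<close>. The model is the usual one by
  \<open>H\<close>-equivariant functions on \<open>G\<close>, with \<open>G\<close> acting by right translation of the argument.\<close>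

definition ind_space ::
  "('h \<Rightarrow> 'g) \<Rightarrow> 'h monoid \<Rightarrow> 'g monoid \<Rightarrow> ('h, 'v) rep \<Rightarrow> ('g \<Rightarrow> 'v) set" where
  "ind_space \<iota> H G V = {f \<in> carrier G \<rightarrow>\<^sub>E carrier V.
     \<forall>h\<in>carrier H. \<forall>g\<in>carrier G. f (\<iota> h \<otimes>\<^bsub>G\<^esub> g) = act V h (f g)}"

definition ind_rep ::
  "('h \<Rightarrow> 'g) \<Rightarrow> 'h monoid \<Rightarrow> 'g monoid \<Rightarrow> ('h, 'v) rep \<Rightarrow> ('g, 'g \<Rightarrow> 'v) rep" where
  "ind_rep \<iota> H G V =
    \<lparr>carrier = ind_space \<iota> H G V, monoid.mult = undefined, one = undefined,
     zero = (\<lambda>g\<in>carrier G. \<zero>\<^bsub>V\<^esub>),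
     add = (\<lambda>f f'. \<lambda>g\<in>carrier G. f g \<oplus>\<^bsub>V\<^esub> f' g),
     module.smult = (\<lambda>c f. \<lambda>g\<in>carrier G. c \<odot>\<^bsub>V\<^esub> f g),
     act = (\<lambda>x. \<lambda>f\<in>ind_space \<iota> H G V. \<lambda>g\<in>carrier G. f (g \<otimes>\<^bsub>G\<^esub> x))\<rparr>"


section \<open>External tensor products\<close>

definition free_module :: "'x set \<Rightarrow> (complex, 'x \<Rightarrow>\<^sub>0 complex) module" where
  "free_module B = \<lparr>carrier = {f. Poly_Mapping.keys f \<subseteq> B},
     monoid.mult = undefined, one = undefined, zero = 0, add = (+), module.smult = (\<lambda>c. Poly_Mapping.map ((*) c))\<rparr>"

text \<open>The linear extension of a map between bases.\<close>

definition free_map :: "('x \<Rightarrow> 'y) \<Rightarrow> ('x \<Rightarrow>\<^sub>0 complex) \<Rightarrow> ('y \<Rightarrow>\<^sub>0 complex)" where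
  "free_map \<phi> f =
    (\<Sum>x\<in>Poly_Mapping.keys f. Poly_Mapping.single (\<phi> x) (Poly_Mapping.lookup f x))"

definition quotient_module :: "(complex, 'v) module \<Rightarrow> 'v set \<Rightarrow> (complex, 'v set) module" where
  "quotient_module M N = \<lparr>carrier = a_rcosets\<^bsub>M\<^esub> N, monoid.mult = undefined, one = undefined,
     zero = N, add = set_add M,
     module.smult = (\<lambda>c A. \<Union>a\<in>A. N +>\<^bsub>M\<^esub> (c \<odot>\<^bsub>M\<^esub> a))\<rparr>"

definition bilinear_relators ::
  "('g, 'v) rep \<Rightarrow> ('h, 'w) rep \<Rightarrow> ('v \<times> 'w \<Rightarrow>\<^sub>0 complex) set" where
  "bilinear_relators V W = (let e = (\<lambda>v w. Poly_Mapping.single (v, w) 1) in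
     {e (v \<oplus>\<^bsub>V\<^esub> v') w - e v w - e v' w | v v' w.
        v \<in> carrier V \<and> v' \<in> carrier V \<and> w \<in> carrier W} \<union>
     {e v (w \<oplus>\<^bsub>W\<^esub> w') - e v w - e v w' | v w w'.
        v \<in> carrier V \<and> w \<in> carrier W \<and> w' \<in> carrier W} \<union>
     {e (c \<odot>\<^bsub>V\<^esub> v) w - Poly_Mapping.single (v, w) c | c v w.
        v \<in> carrier V \<and> w \<in> carrier W} \<union>
     {e v (c \<odot>\<^bsub>W\<^esub> w) - Poly_Mapping.single (v, w) c | c v w.
        v \<in> carrier V \<and> w \<in> carrier W})"

definition tensor_module ::
  "('g, 'v) rep \<Rightarrow> ('h, 'w) rep \<Rightarrow> (complex, ('v \<times> 'w \<Rightarrow>\<^sub>0 complex) set) module" where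
  "tensor_module V W = (let F = free_module (carrier V \<times> carrier W) in
     quotient_module F ((\<lambda>N. submodule N complex_field F) hull bilinear_relators V W))"

text \<open>On a coset, the action \<open>v \<otimes> w \<mapsto> g v \<otimes> h w\<close> is the image of the coset under the linear
  extension of \<open>(v, w) \<mapsto> (g v, h w)\<close>, since that extension permutes the relators.\<close>

definition external_tensor ::
  "('g, 'v) rep \<Rightarrow> ('h, 'w) rep \<Rightarrow> ('g \<times> 'h, ('v \<times> 'w \<Rightarrow>\<^sub>0 complex) set) rep" where
  "external_tensor V W = module.extend (tensor_module V W)
     (rep.fields (\<lambda>(g, h). \<lambda>A\<in>carrier (tensor_module V W).
        free_map (map_prod (act V g) (act W h)) ` A))"


section \<open>Groups of permutations\<close>

definition perm_group :: "'a set \<Rightarrow> ('a \<Rightarrow> 'a) monoid" where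
  "perm_group A = \<lparr>carrier = {p. p permutes A}, monoid.mult = (\<circ>), one = id\<rparr>"

text \<open>The point \<open>(j - 1) * m + i\<close> with \<open>1 \<le> i \<le> m\<close> is the \<open>i\<close>-th point of the \<open>j\<close>-th block. The
  permutation with data \<open>\<sigma>\<close>, \<open>\<tau>\<close> first applies \<open>\<tau> j\<close> inside each block \<open>j\<close> and then permutes the
  blocks by \<open>\<sigma>\<close>, so that these permutations form the semidirect product of \<open>K\<close> to the \<open>n\<close> by the
  symmetric group of degree \<open>n\<close>, for a subgroup \<open>K\<close> of the symmetric group of degree \<open>m\<close>.\<close>

definition block_wreath :: "(nat \<Rightarrow> nat) set \<Rightarrow> nat \<Rightarrow> nat \<Rightarrow> (nat \<Rightarrow> nat) set" where
  "block_wreath K m n = {p. p permutes {1..m * n} \<and>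
     (\<exists>\<sigma> \<tau>. \<sigma> permutes {1..n} \<and> (\<forall>j\<in>{1..n}. \<tau> j \<in> K) \<and>
       (\<forall>j\<in>{1..n}. \<forall>i\<in>{1..m}. p ((j - 1) * m + i) = (\<sigma> j - 1) * m + \<tau> j i))}"

definition C_group :: "nat \<Rightarrow> nat \<Rightarrow> (nat \<Rightarrow> nat) monoid" where
  "C_group m n =
    (sym_group (m * n))\<lparr>carrier := block_wreath (carrier (sym_group m)) m n\<rparr>"

text \<open>Here \<open>c\<close> is the \<open>m\<close>-cycle chosen as generator of the cyclic group of order \<open>m\<close>.\<close>

definition D_group :: "(nat \<Rightarrow> nat) \<Rightarrow> nat \<Rightarrow> nat \<Rightarrow> (nat \<Rightarrow> nat) monoid" where
  "D_group c m n =
    (sym_group (m * n))\<lparr>carrier := block_wreath (generate (sym_group m) {c}) m n\<rparr>"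

end

theory Submission
  imports Defs
begin

text \<open>Let \<open>W(K, n)\<close> be the wreath product of \<open>K \<le> S\<^sub>m\<close> acting on \<open>n\<close> consecutive blocks of size \<open>m\<close>.
  Both rules are the same statement for two choices of \<open>K\<close>: all of \<open>S\<^sub>m\<close>, and the cyclic group
  generated by an \<open>m\<close>-cycle.

  Suppose that \<open>K\<close> is transitive on the \<open>m\<close> points. Then \<open>W(K, n)\<close> is transitive on the \<open>m n\<close>
  points, so the symmetric group of degree \<open>m n\<close> is the product of \<open>W(K, n)\<close> and the stabilizer \<open>S\<close>
  of the last point. Mackey's formula then has a single term: the restriction to \<open>S\<close> of the
  representation induced from the trivial representation of \<open>W(K, n)\<close> is induced from the trivial
  representation of \<open>W(K, n) \<inter> S\<close> (\<open>mackey_single_double_coset\<close>). An element of \<open>W(K, n)\<close> that fixes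
  the last point maps the last block to itself and acts on it by an element of \<open>K\<close> that fixes \<open>m\<close>.
  Hence \<open>W(K, n) \<inter> S\<close> is the product of \<open>W(K, n - 1)\<close> and the point stabilizer \<open>K\<^sub>m\<close>
  (\<open>block_wreath_point_stabilizer\<close>).

  On the other side, let \<open>\<pi>\<close> be a surjection from \<open>H\<close> onto \<open>L\<close>. Inducing from \<open>H\<close> to \<open>G\<close> the
  pullback along \<open>\<pi>\<close> of a representation induced from the trivial one of \<open>K' \<le> L\<close> amounts to inducing
  the trivial representation of the preimage of \<open>K'\<close> (\<open>ind_stages\<close>). For \<open>K = S\<^sub>m\<close> this is applied to
  the projection of \<open>S\<^bsub>(n-1)m\<^esub> \<times> S\<^bsub>m-1\<^esub>\<close> to its first factor, and the preimage of \<open>W(K, n - 1)\<close> is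
  \<open>W(K, n - 1) \<times> K\<^sub>m\<close>; the pullback is isomorphic to the external tensor product with the trivial
  representation (\<open>external_tensor_triv\<close>). For the cyclic group, the stabilizer \<open>K\<^sub>m\<close> is trivial
  (\<open>cyclic_group_free\<close>) and \<open>\<pi>\<close> is the identity.\<close>

section \<open>Complex representations\<close>

lemma complex_field_simps [simp]:
  "carrier complex_field = UNIV" "x \<otimes>\<^bsub>complex_field\<^esub> y = x * y" "\<one>\<^bsub>complex_field\<^esub> = 1"
  "\<zero>\<^bsub>complex_field\<^esub> = 0" "x \<oplus>\<^bsub>complex_field\<^esub> y = x + y"
  by (simp_all add: ring_of_type_algebra_def)

lemma complex_moduleI:
  fixes V :: "(complex, 'v, 'b) module_scheme" (structure)
  assumes "\<zero> \<in> carrier V"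
    and "\<And>v w. \<lbrakk>v \<in> carrier V; w \<in> carrier V\<rbrakk> \<Longrightarrow> v \<oplus> w \<in> carrier V"
    and "\<And>u v w. \<lbrakk>u \<in> carrier V; v \<in> carrier V; w \<in> carrier V\<rbrakk>
      \<Longrightarrow> u \<oplus> v \<oplus> w = u \<oplus> (v \<oplus> w)"
    and "\<And>v w. \<lbrakk>v \<in> carrier V; w \<in> carrier V\<rbrakk> \<Longrightarrow> v \<oplus> w = w \<oplus> v"
    and "\<And>v. v \<in> carrier V \<Longrightarrow> \<zero> \<oplus> v = v"
    and "\<And>c v. v \<in> carrier V \<Longrightarrow> c \<odot> v \<in> carrier V"
    and "\<And>c d v. v \<in> carrier V \<Longrightarrow> (c + d) \<odot> v = c \<odot> v \<oplus> d \<odot> v"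
    and "\<And>c v w. \<lbrakk>v \<in> carrier V; w \<in> carrier V\<rbrakk>
      \<Longrightarrow> c \<odot> (v \<oplus> w) = c \<odot> v \<oplus> c \<odot> w"
    and "\<And>c d v. v \<in> carrier V \<Longrightarrow> (c * d) \<odot> v = c \<odot> (d \<odot> v)"
    and "\<And>v. v \<in> carrier V \<Longrightarrow> 1 \<odot> v = v"
    and "\<And>v. v \<in> carrier V \<Longrightarrow> 0 \<odot> v = \<zero>"
  shows "module complex_field V"
proof (rule moduleI)
  show "abelian_group V"
  proof (rule abelian_groupI)
    show "\<exists>w\<in>carrier V. w \<oplus> v = \<zero>" if "v \<in> carrier V" for v
    proof
      show "(-1) \<odot> v \<oplus> v = \<zero>"
        using assms(7)[OF that, of "-1" 1] assms(10,11)[OF that] by simp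
    qed (use assms(6) that in auto)
  qed (use assms in auto)
qed (use assms in \<open>auto intro: cring_from_type_algebra\<close>)

text \<open>Commutativity of addition is kept in a separate lemma, so that this list can serve as a set
  of rewrite rules.\<close>

lemma complex_moduleD:
  fixes V :: "(complex, 'v, 'b) module_scheme" (structure)
  assumes "module complex_field V"
  shows "\<zero> \<in> carrier V"
    and "\<And>v w. \<lbrakk>v \<in> carrier V; w \<in> carrier V\<rbrakk> \<Longrightarrow> v \<oplus> w \<in> carrier V"
    and "\<And>u v w. \<lbrakk>u \<in> carrier V; v \<in> carrier V; w \<in> carrier V\<rbrakk>
      \<Longrightarrow> u \<oplus> v \<oplus> w = u \<oplus> (v \<oplus> w)"
    and "\<And>v. v \<in> carrier V \<Longrightarrow> \<zero> \<oplus> v = v"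
    and "\<And>c v. v \<in> carrier V \<Longrightarrow> c \<odot> v \<in> carrier V"
    and "\<And>c d v. v \<in> carrier V \<Longrightarrow> (c + d) \<odot> v = c \<odot> v \<oplus> d \<odot> v"
    and "\<And>c v w. \<lbrakk>v \<in> carrier V; w \<in> carrier V\<rbrakk>
      \<Longrightarrow> c \<odot> (v \<oplus> w) = c \<odot> v \<oplus> c \<odot> w"
    and "\<And>c d v. v \<in> carrier V \<Longrightarrow> (c * d) \<odot> v = c \<odot> (d \<odot> v)"
    and "\<And>v. v \<in> carrier V \<Longrightarrow> 1 \<odot> v = v"
    and "\<And>v. v \<in> carrier V \<Longrightarrow> 0 \<odot> v = \<zero>"
proof -
  interpret module complex_field V by fact
  show "\<zero> \<in> carrier V" by simp
  show "v \<oplus> w \<in> carrier V" if "v \<in> carrier V" "w \<in> carrier V" for v w using that by simp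
  show "u \<oplus> v \<oplus> w = u \<oplus> (v \<oplus> w)" if "u \<in> carrier V" "v \<in> carrier V" "w \<in> carrier V" for u v w
    using that by (rule M.a_assoc)
  show "\<zero> \<oplus> v = v" if "v \<in> carrier V" for v using that by simp
  show "c \<odot> v \<in> carrier V" if "v \<in> carrier V" for c v using that by simp
  show "(c + d) \<odot> v = c \<odot> v \<oplus> d \<odot> v" if "v \<in> carrier V" for c d v
    using smult_l_distr[of c d v] that by simp
  show "c \<odot> (v \<oplus> w) = c \<odot> v \<oplus> c \<odot> w" if "v \<in> carrier V" "w \<in> carrier V" for c v w
    using smult_r_distr[of c v w] that by simp
  show "(c * d) \<odot> v = c \<odot> (d \<odot> v)" if "v \<in> carrier V" for c d v
    using smult_assoc1[of c d v] that by simp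
  show "1 \<odot> v = v" if "v \<in> carrier V" for v using smult_one[of v] that by simp
  show "0 \<odot> v = \<zero>" if "v \<in> carrier V" for v using smult_l_null[of v] that by simp
qed

lemma complex_module_commute:
  fixes V :: "(complex, 'v, 'b) module_scheme" (structure)
  assumes "module complex_field V" and "v \<in> carrier V" and "w \<in> carrier V"
  shows "v \<oplus> w = w \<oplus> v"
proof -
  interpret module complex_field V by fact
  show ?thesis using assms(2,3) by (rule M.a_comm)
qed

lemma representationI:
  fixes V :: "('g, 'v, 'b) rep_scheme" and G (structure)
  assumes G: "group G" and V: "module complex_field V"
    and ext: "\<And>g. g \<in> carrier G \<Longrightarrow> act V g \<in> extensional (carrier V)"
    and closed: "\<And>g v. \<lbrakk>g \<in> carrier G; v \<in> carrier V\<rbrakk> \<Longrightarrow> act V g v \<in> carrier V"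
    and one: "\<And>v. v \<in> carrier V \<Longrightarrow> act V \<one> v = v"
    and mult: "\<And>g h v. \<lbrakk>g \<in> carrier G; h \<in> carrier G; v \<in> carrier V\<rbrakk>
      \<Longrightarrow> act V (g \<otimes> h) v = act V g (act V h v)"
    and add: "\<And>g v w. \<lbrakk>g \<in> carrier G; v \<in> carrier V; w \<in> carrier V\<rbrakk>
      \<Longrightarrow> act V g (v \<oplus>\<^bsub>V\<^esub> w) = act V g v \<oplus>\<^bsub>V\<^esub> act V g w"
    and smult: "\<And>g c v. \<lbrakk>g \<in> carrier G; v \<in> carrier V\<rbrakk>
      \<Longrightarrow> act V g (c \<odot>\<^bsub>V\<^esub> v) = c \<odot>\<^bsub>V\<^esub> act V g v"
  shows "representation G V"
proof -
  interpret group G by (rule G)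
  have inv: "act V (inv g) (act V g v) = v" "act V g (act V (inv g) v) = v"
    if "g \<in> carrier G" "v \<in> carrier V" for g v
    using that mult[of "inv g" g v] mult[of g "inv g" v] one by auto
  have bij: "act V g \<in> Bij (carrier V)" if g: "g \<in> carrier G" for g
  proof -
    have "bij_betw (act V g) (carrier V) (carrier V)"
      by (rule bij_betwI[where g="act V (inv g)"]) (use g closed inv in auto)
    then show ?thesis using ext[OF g] by (simp add: Bij_def)
  qed
  have "act V \<in> hom G (BijGroup (carrier V))"
  proof (rule homI)
    show "act V (g \<otimes> h) = act V g \<otimes>\<^bsub>BijGroup (carrier V)\<^esub> act V h"
      if "g \<in> carrier G" "h \<in> carrier G" for g h
    proof (rule extensionalityI[where A="carrier V"])
      show "act V (g \<otimes> h) \<in> extensional (carrier V)" using that ext by auto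
      show "act V g \<otimes>\<^bsub>BijGroup (carrier V)\<^esub> act V h \<in> extensional (carrier V)"
        using that bij by (simp add: BijGroup_def compose_def)
      show "act V (g \<otimes> h) v = (act V g \<otimes>\<^bsub>BijGroup (carrier V)\<^esub> act V h) v"
        if "v \<in> carrier V" for v
        using that \<open>g \<in> carrier G\<close> \<open>h \<in> carrier G\<close> bij mult
        by (simp add: BijGroup_def compose_def)
    qed
  qed (use bij in \<open>auto simp: BijGroup_def\<close>)
  then have "group_action G (carrier V) (act V)"
    unfolding group_action_def group_hom_def group_hom_axioms_def
    using group_BijGroup G by auto
  then show ?thesis
    unfolding representation_def representation_axioms_def using V add smult by auto
qed

lemma representationD:
  fixes V :: "('g, 'v, 'b) rep_scheme" and G (structure)
  assumes "representation G V"
  shows "group G" and "module complex_field V"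
    and "\<And>g. g \<in> carrier G \<Longrightarrow> act V g \<in> extensional (carrier V)"
    and "\<And>g v. \<lbrakk>g \<in> carrier G; v \<in> carrier V\<rbrakk> \<Longrightarrow> act V g v \<in> carrier V"
    and "\<And>v. v \<in> carrier V \<Longrightarrow> act V \<one> v = v"
    and "\<And>g h v. \<lbrakk>g \<in> carrier G; h \<in> carrier G; v \<in> carrier V\<rbrakk>
      \<Longrightarrow> act V (g \<otimes> h) v = act V g (act V h v)"
    and "\<And>g v w. \<lbrakk>g \<in> carrier G; v \<in> carrier V; w \<in> carrier V\<rbrakk>
      \<Longrightarrow> act V g (v \<oplus>\<^bsub>V\<^esub> w) = act V g v \<oplus>\<^bsub>V\<^esub> act V g w"
    and "\<And>g c v. \<lbrakk>g \<in> carrier G; v \<in> carrier V\<rbrakk>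
      \<Longrightarrow> act V g (c \<odot>\<^bsub>V\<^esub> v) = c \<odot>\<^bsub>V\<^esub> act V g v"
proof -
  interpret representation G V by fact
  show "group G" using group_hom by (simp add: group_hom_def)
  show "module complex_field V" by (rule module_axioms)
  show "act V g \<in> extensional (carrier V)" if "g \<in> carrier G" for g
    using bij_prop0[OF that] by (simp add: Bij_def)
  show "act V g v \<in> carrier V" if "g \<in> carrier G" "v \<in> carrier V" for g v
    using element_image that by blast
  show "act V \<one> v = v" if "v \<in> carrier V" for v
    using id_eq_one that by (metis restrict_apply')
  show "act V (g \<otimes> h) v = act V g (act V h v)"
    if "g \<in> carrier G" "h \<in> carrier G" "v \<in> carrier V" for g h v
    using composition_rule that by blast
qed (use assms in \<open>auto simp: representation_def representation_axioms_def\<close>)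

text \<open>The laws of a representation are equations between operations that \<open>\<phi>\<close> preserves, so they hold
  in \<open>W\<close> because they hold in \<open>V\<close>. For a quotient such as a tensor product, this yields the module
  structure together with the isomorphism. Extensionality of the action of \<open>W\<close> is an assumption
  because it concerns values outside the carrier, about which \<open>\<phi>\<close> says nothing.\<close>

lemma rep_iso_transport:
  fixes V :: "('g, 'v, 'b) rep_scheme" and W :: "('g, 'w, 'c) rep_scheme"
  assumes V: "representation G V" and bij: "bij_betw \<phi> (carrier V) (carrier W)"
    and zero: "\<zero>\<^bsub>W\<^esub> = \<phi> \<zero>\<^bsub>V\<^esub>"
    and add: "\<And>v w. \<lbrakk>v \<in> carrier V; w \<in> carrier V\<rbrakk> \<Longrightarrow> \<phi> (v \<oplus>\<^bsub>V\<^esub> w) = \<phi> v \<oplus>\<^bsub>W\<^esub> \<phi> w"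
    and smult: "\<And>c v. v \<in> carrier V \<Longrightarrow> \<phi> (c \<odot>\<^bsub>V\<^esub> v) = c \<odot>\<^bsub>W\<^esub> \<phi> v"
    and act: "\<And>g v. \<lbrakk>g \<in> carrier G; v \<in> carrier V\<rbrakk> \<Longrightarrow> \<phi> (act V g v) = act W g (\<phi> v)"
    and ext: "\<And>g. g \<in> carrier G \<Longrightarrow> act W g \<in> extensional (carrier W)"
  shows "rep_iso G V W"
proof -
  note rV = representationD[OF V]
  note mV = complex_moduleD[OF rV(2)]
  have cW: "carrier W = \<phi> ` carrier V" using bij by (simp add: bij_betw_def)
  note eqs = add[symmetric] smult[symmetric] act[symmetric] zero
  have mod: "module complex_field W"
  proof (rule complex_moduleI)
    show "\<zero>\<^bsub>W\<^esub> \<in> carrier W" by (simp add: cW eqs(4) mV(1))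
    show "v \<oplus>\<^bsub>W\<^esub> w = w \<oplus>\<^bsub>W\<^esub> v" if "v \<in> carrier W" "w \<in> carrier W" for v w
      using that complex_module_commute[OF rV(2)] by (force simp: cW eqs(1))
  qed (auto simp: cW eqs mV)
  have "representation G W"
  proof (rule representationI[OF rV(1) mod])
    show "act W g w \<in> carrier W" if "g \<in> carrier G" "w \<in> carrier W" for g w
      using that rV(4) by (auto simp: cW eqs)
    show "act W \<one>\<^bsub>G\<^esub> w = w" if "w \<in> carrier W" for w
      using that rV(5) group.is_monoid[OF rV(1)] by (auto simp: cW eqs)
    show "act W (g \<otimes>\<^bsub>G\<^esub> h) w = act W g (act W h w)"
      if "g \<in> carrier G" "h \<in> carrier G" "w \<in> carrier W" for g h w
      using that rV(4,6) group.is_monoid[OF rV(1)] by (auto simp: cW eqs monoid.m_closed)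
    show "act W g (v \<oplus>\<^bsub>W\<^esub> w) = act W g v \<oplus>\<^bsub>W\<^esub> act W g w"
      if "g \<in> carrier G" "v \<in> carrier W" "w \<in> carrier W" for g v w
      using that rV(4,7) mV by (auto simp: cW eqs)
    show "act W g (c \<odot>\<^bsub>W\<^esub> v) = c \<odot>\<^bsub>W\<^esub> act W g v"
      if "g \<in> carrier G" "v \<in> carrier W" for g c v
      using that rV(4,8) mV by (auto simp: cW eqs)
  qed (rule ext)
  then show ?thesis
    unfolding rep_iso_def using V bij add smult act by blast
qed

lemma rep_iso_sym:
  assumes "rep_iso G V W" shows "rep_iso G W V"
proof -
  from assms obtain \<phi> where V: "representation G V" and W: "representation G W"
    and bij: "bij_betw \<phi> (carrier V) (carrier W)"
    and hom: "\<And>v w. v \<in> carrier V \<Longrightarrow> w \<in> carrier V \<Longrightarrow> \<phi> (v \<oplus>\<^bsub>V\<^esub> w) = \<phi> v \<oplus>\<^bsub>W\<^esub> \<phi> w"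
      "\<And>c v. v \<in> carrier V \<Longrightarrow> \<phi> (c \<odot>\<^bsub>V\<^esub> v) = c \<odot>\<^bsub>W\<^esub> \<phi> v"
      "\<And>g v. g \<in> carrier G \<Longrightarrow> v \<in> carrier V \<Longrightarrow> \<phi> (act V g v) = act W g (\<phi> v)"
    unfolding rep_iso_def by blast
  note rV = representationD[OF V]
  note mV = complex_moduleD[OF rV(2)]
  let ?\<psi> = "the_inv_into (carrier V) \<phi>"
  have cW: "carrier W = \<phi> ` carrier V" and inj: "inj_on \<phi> (carrier V)"
    using bij by (auto simp: bij_betw_def)
  have inv: "?\<psi> (\<phi> v) = v" if "v \<in> carrier V" for v
    by (rule the_inv_into_f_f[OF inj that])
  have "bij_betw ?\<psi> (carrier W) (carrier V)" by (rule bij_betw_the_inv_into[OF bij])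
  then show ?thesis
    unfolding rep_iso_def using V W
    by (auto intro!: exI[of _ ?\<psi>] simp: cW hom[symmetric] inv mV rV)
qed

lemma rep_iso_trans:
  assumes "rep_iso G U V" "rep_iso G V W" shows "rep_iso G U W"
proof -
  from assms(1) obtain \<phi> where U: "representation G U"
    and bij1: "bij_betw \<phi> (carrier U) (carrier V)"
    and hom1: "\<forall>v\<in>carrier U. \<forall>w\<in>carrier U. \<phi> (v \<oplus>\<^bsub>U\<^esub> w) = \<phi> v \<oplus>\<^bsub>V\<^esub> \<phi> w"
      "\<forall>c. \<forall>v\<in>carrier U. \<phi> (c \<odot>\<^bsub>U\<^esub> v) = c \<odot>\<^bsub>V\<^esub> \<phi> v"
      "\<forall>g\<in>carrier G. \<forall>v\<in>carrier U. \<phi> (act U g v) = act V g (\<phi> v)"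
    unfolding rep_iso_def by blast
  from assms(2) obtain \<psi> where W: "representation G W"
    and bij2: "bij_betw \<psi> (carrier V) (carrier W)"
    and hom2: "\<forall>v\<in>carrier V. \<forall>w\<in>carrier V. \<psi> (v \<oplus>\<^bsub>V\<^esub> w) = \<psi> v \<oplus>\<^bsub>W\<^esub> \<psi> w"
      "\<forall>c. \<forall>v\<in>carrier V. \<psi> (c \<odot>\<^bsub>V\<^esub> v) = c \<odot>\<^bsub>W\<^esub> \<psi> v"
      "\<forall>g\<in>carrier G. \<forall>v\<in>carrier V. \<psi> (act V g v) = act W g (\<psi> v)"
    unfolding rep_iso_def by blast
  have \<phi>: "\<phi> v \<in> carrier V" if "v \<in> carrier U" for v
    using bij1 that by (rule bij_betw_apply)
  show ?thesis
    unfolding rep_iso_def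
    using U W bij_betw_trans[OF bij1 bij2]
    by (intro conjI exI[of _ "\<psi> \<circ> \<phi>"]) (simp_all add: hom1 hom2 \<phi>)
qed

section \<open>Trivial, pulled back, induced and restricted representations\<close>

text \<open>The multiplication and unit of the underlying record have no meaning for a module; copying them
  makes the pullback along the identity equal to \<open>V\<close>, and not merely isomorphic to it.\<close>

definition pull_rep :: "('h \<Rightarrow> 'g) \<Rightarrow> ('g, 'v) rep \<Rightarrow> ('h, 'v) rep" where
  "pull_rep \<pi> V = \<lparr>carrier = carrier V, monoid.mult = monoid.mult V, one = one V, zero = zero V,
     add = add V, module.smult = module.smult V, act = act V \<circ> \<pi>\<rparr>"

lemma pull_rep_sel [simp]:
  "carrier (pull_rep \<pi> V) = carrier V" "zero (pull_rep \<pi> V) = zero V"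
  "add (pull_rep \<pi> V) = add V" "module.smult (pull_rep \<pi> V) = module.smult V"
  "act (pull_rep \<pi> V) h = act V (\<pi> h)"
  by (simp_all add: pull_rep_def)

lemma pull_rep_id: "pull_rep id V = V"
  by (cases V) (simp add: pull_rep_def)

lemma pull_representation:
  assumes "group H" "\<pi> \<in> hom H L" "representation L V"
  shows "representation H (pull_rep \<pi> V)"
proof -
  note rV = representationD[OF assms(3)]
  interpret group_hom H L \<pi>
    using assms(1,2) rV(1) by (simp add: group_hom_def group_hom_axioms_def)
  show ?thesis
  proof (rule representationI[OF assms(1)])
    show "module complex_field (pull_rep \<pi> V)"
      by (rule complex_moduleI)
        (auto simp: complex_moduleD[OF rV(2)] intro: complex_module_commute[OF rV(2)])
  qed (simp_all add: rV)
qed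

lemma ind_rep_sel [simp]:
  "carrier (ind_rep \<iota> H G V) = ind_space \<iota> H G V"
  "zero (ind_rep \<iota> H G V) = (\<lambda>g\<in>carrier G. \<zero>\<^bsub>V\<^esub>)"
  "f \<oplus>\<^bsub>ind_rep \<iota> H G V\<^esub> f' = (\<lambda>g\<in>carrier G. f g \<oplus>\<^bsub>V\<^esub> f' g)"
  "c \<odot>\<^bsub>ind_rep \<iota> H G V\<^esub> f = (\<lambda>g\<in>carrier G. c \<odot>\<^bsub>V\<^esub> f g)"
  "act (ind_rep \<iota> H G V) x = (\<lambda>f\<in>ind_space \<iota> H G V. \<lambda>g\<in>carrier G. f (g \<otimes>\<^bsub>G\<^esub> x))"
  by (simp_all add: ind_rep_def)

lemma ind_spaceI:
  assumes "f \<in> extensional (carrier G)" "\<And>g. g \<in> carrier G \<Longrightarrow> f g \<in> carrier V"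
    and "\<And>h g. h \<in> carrier H \<Longrightarrow> g \<in> carrier G \<Longrightarrow> f (\<iota> h \<otimes>\<^bsub>G\<^esub> g) = act V h (f g)"
  shows "f \<in> ind_space \<iota> H G V"
  using assms by (auto simp: ind_space_def PiE_def)

lemma ind_spaceD:
  assumes "f \<in> ind_space \<iota> H G V"
  shows "f \<in> extensional (carrier G)" "\<And>g. g \<in> carrier G \<Longrightarrow> f g \<in> carrier V"
    and "\<And>h g. h \<in> carrier H \<Longrightarrow> g \<in> carrier G \<Longrightarrow> f (\<iota> h \<otimes>\<^bsub>G\<^esub> g) = act V h (f g)"
  using assms by (auto simp: ind_space_def PiE_def)

lemma ind_space_act:
  assumes "group G" "\<iota> \<in> carrier H \<rightarrow> carrier G" "f \<in> ind_space \<iota> H G V" "x \<in> carrier G"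
  shows "(\<lambda>g\<in>carrier G. f (g \<otimes>\<^bsub>G\<^esub> x)) \<in> ind_space \<iota> H G V"
proof -
  interpret group G by fact
  have "\<iota> h \<in> carrier G" if "h \<in> carrier H" for h using assms(2) that by auto
  then show ?thesis
    by (intro ind_spaceI) (use assms(4) in \<open>auto simp: m_assoc ind_spaceD[OF assms(3)]\<close>)
qed

text \<open>Equivariance is a linear condition on functions for each element of \<open>H\<close>, since \<open>H\<close> acts
  linearly on the values; its solutions therefore form a space. Right translations preserve this
  space because they commute with left multiplications.\<close>

lemma ind_representation:
  fixes V :: "('h, 'v) rep"
  assumes G: "group G" and \<iota>: "\<iota> \<in> carrier H \<rightarrow> carrier G" and V: "module complex_field V"
    and closed: "\<And>h v. \<lbrakk>h \<in> carrier H; v \<in> carrier V\<rbrakk> \<Longrightarrow> act V h v \<in> carrier V"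
    and add: "\<And>h v w. \<lbrakk>h \<in> carrier H; v \<in> carrier V; w \<in> carrier V\<rbrakk>
      \<Longrightarrow> act V h (v \<oplus>\<^bsub>V\<^esub> w) = act V h v \<oplus>\<^bsub>V\<^esub> act V h w"
    and smult: "\<And>h c v. \<lbrakk>h \<in> carrier H; v \<in> carrier V\<rbrakk>
      \<Longrightarrow> act V h (c \<odot>\<^bsub>V\<^esub> v) = c \<odot>\<^bsub>V\<^esub> act V h v"
  shows "representation G (ind_rep \<iota> H G V)"
proof -
  interpret group G by (rule G)
  note mV = complex_moduleD[OF V]
  have \<iota>': "\<iota> h \<in> carrier G" if "h \<in> carrier H" for h using \<iota> that by auto
  have act_zero: "act V h \<zero>\<^bsub>V\<^esub> = \<zero>\<^bsub>V\<^esub>" if "h \<in> carrier H" for h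
    using smult[of h "\<zero>\<^bsub>V\<^esub>" 0] closed[of h "\<zero>\<^bsub>V\<^esub>"] mV(1,10) that by metis
  note D = ind_spaceD
  have mod: "module complex_field (ind_rep \<iota> H G V)"
  proof (rule complex_moduleI)
    show "\<zero>\<^bsub>ind_rep \<iota> H G V\<^esub> \<in> carrier (ind_rep \<iota> H G V)"
      by (auto intro!: ind_spaceI simp: mV \<iota>' act_zero)
    show "f \<oplus>\<^bsub>ind_rep \<iota> H G V\<^esub> f' \<in> carrier (ind_rep \<iota> H G V)"
      if "f \<in> carrier (ind_rep \<iota> H G V)" "f' \<in> carrier (ind_rep \<iota> H G V)" for f f'
      using that by (auto intro!: ind_spaceI simp: mV \<iota>' D add)
    show "c \<odot>\<^bsub>ind_rep \<iota> H G V\<^esub> f \<in> carrier (ind_rep \<iota> H G V)"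
      if "f \<in> carrier (ind_rep \<iota> H G V)" for c f
      using that by (auto intro!: ind_spaceI simp: mV \<iota>' D smult)
  next
    show "\<zero>\<^bsub>ind_rep \<iota> H G V\<^esub> \<oplus>\<^bsub>ind_rep \<iota> H G V\<^esub> f = f" "1 \<odot>\<^bsub>ind_rep \<iota> H G V\<^esub> f = f"
      if "f \<in> carrier (ind_rep \<iota> H G V)" for f
      using that by (auto simp: mV D intro!: extensionalityI[where A="carrier G"])
    show "f \<oplus>\<^bsub>ind_rep \<iota> H G V\<^esub> f' = f' \<oplus>\<^bsub>ind_rep \<iota> H G V\<^esub> f"
      if "f \<in> carrier (ind_rep \<iota> H G V)" "f' \<in> carrier (ind_rep \<iota> H G V)" for f f'
      using that by (auto simp: D complex_module_commute[OF V] intro!: restrict_ext)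
  qed (auto simp: mV D cong: restrict_cong)
  show ?thesis
  proof (rule representationI[OF G mod])
    show "act (ind_rep \<iota> H G V) \<one>\<^bsub>G\<^esub> f = f" if "f \<in> carrier (ind_rep \<iota> H G V)" for f
      using that by (auto simp: D intro!: extensionalityI[where A="carrier G"])
    show "act (ind_rep \<iota> H G V) (x \<otimes>\<^bsub>G\<^esub> y) f = act (ind_rep \<iota> H G V) x (act (ind_rep \<iota> H G V) y f)"
      if "x \<in> carrier G" "y \<in> carrier G" "f \<in> carrier (ind_rep \<iota> H G V)" for x y f
      using that by (auto simp: m_assoc ind_space_act[OF G \<iota>])
    show "act (ind_rep \<iota> H G V) x (f \<oplus>\<^bsub>ind_rep \<iota> H G V\<^esub> f')
        = act (ind_rep \<iota> H G V) x f \<oplus>\<^bsub>ind_rep \<iota> H G V\<^esub> act (ind_rep \<iota> H G V) x f'"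
      if "x \<in> carrier G" "f \<in> carrier (ind_rep \<iota> H G V)" "f' \<in> carrier (ind_rep \<iota> H G V)" for x f f'
      using that complex_moduleD(2)[OF mod, of f f'] by auto
    show "act (ind_rep \<iota> H G V) x (c \<odot>\<^bsub>ind_rep \<iota> H G V\<^esub> f)
        = c \<odot>\<^bsub>ind_rep \<iota> H G V\<^esub> act (ind_rep \<iota> H G V) x f"
      if "x \<in> carrier G" "f \<in> carrier (ind_rep \<iota> H G V)" for x c f
      using that complex_moduleD(5)[OF mod, of f c] by auto
  qed (auto simp: ind_space_act[OF G \<iota>])
qed

lemma ind_rep_of_representation:
  assumes "group G" "\<iota> \<in> carrier H \<rightarrow> carrier G" "representation H V"
  shows "representation G (ind_rep \<iota> H G V)"
  using ind_representation[OF assms(1,2)] representationD[OF assms(3)] by blast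

lemma ind_triv_representation:
  assumes "group G" "\<iota> \<in> carrier H \<rightarrow> carrier G"
  shows "representation G (ind_rep \<iota> H G triv_rep)"
proof (rule ind_representation[OF assms])
  show "module complex_field triv_rep"
    by (rule complex_moduleI) (auto simp: triv_rep_def algebra_simps)
qed (auto simp: triv_rep_def)

text \<open>Induction is functorial: an isomorphism of representations of \<open>H\<close> is applied to the values
  of equivariant functions.\<close>

lemma ind_rep_iso:
  fixes V :: "('h, 'v) rep" and W :: "('h, 'w) rep"
  assumes G: "group G" and \<iota>: "\<iota> \<in> carrier H \<rightarrow> carrier G" and VW: "rep_iso H V W"
  shows "rep_iso G (ind_rep \<iota> H G V) (ind_rep \<iota> H G W)"
proof -
  interpret group G by (rule G)
  from VW obtain \<phi> where V: "representation H V" and W: "representation H W"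
    and bij: "bij_betw \<phi> (carrier V) (carrier W)"
    and add: "\<And>v w. v \<in> carrier V \<Longrightarrow> w \<in> carrier V \<Longrightarrow> \<phi> (v \<oplus>\<^bsub>V\<^esub> w) = \<phi> v \<oplus>\<^bsub>W\<^esub> \<phi> w"
    and smult: "\<And>c v. v \<in> carrier V \<Longrightarrow> \<phi> (c \<odot>\<^bsub>V\<^esub> v) = c \<odot>\<^bsub>W\<^esub> \<phi> v"
    and act: "\<And>g v. g \<in> carrier H \<Longrightarrow> v \<in> carrier V \<Longrightarrow> \<phi> (act V g v) = act W g (\<phi> v)"
    unfolding rep_iso_def by blast
  note rV = representationD[OF V]
  note mV = complex_moduleD[OF rV(2)]
  note D = ind_spaceD
  have \<iota>': "\<iota> h \<in> carrier G" if "h \<in> carrier H" for h using \<iota> that by auto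
  have cW: "carrier W = \<phi> ` carrier V" and inj: "inj_on \<phi> (carrier V)"
    using bij by (auto simp: bij_betw_def)
  let ?\<psi> = "the_inv_into (carrier V) \<phi>"
  have inv: "?\<psi> (\<phi> v) = v" if "v \<in> carrier V" for v by (rule the_inv_into_f_f[OF inj that])
  have \<psi>: "?\<psi> w \<in> carrier V" "\<phi> (?\<psi> w) = w" if "w \<in> carrier W" for w
    using that inv by (auto simp: cW)
  have \<psi>_act: "?\<psi> (act W h w) = act V h (?\<psi> w)" if "h \<in> carrier H" "w \<in> carrier W" for h w
    using that by (auto simp: cW inv act[symmetric] rV)
  let ?\<Phi> = "\<lambda>f. \<lambda>g\<in>carrier G. \<phi> (f g)" and ?\<Psi> = "\<lambda>f. \<lambda>g\<in>carrier G. ?\<psi> (f g)"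
  have \<Phi>: "?\<Phi> f \<in> ind_space \<iota> H G W" if "f \<in> ind_space \<iota> H G V" for f
    by (rule ind_spaceI) (use that in \<open>auto simp: cW \<iota>' D act\<close>)
  have \<Psi>: "?\<Psi> f \<in> ind_space \<iota> H G V" if "f \<in> ind_space \<iota> H G W" for f
    by (rule ind_spaceI) (use that in \<open>auto simp: \<psi> \<iota>' D \<psi>_act\<close>)
  have "bij_betw ?\<Phi> (ind_space \<iota> H G V) (ind_space \<iota> H G W)"
  proof (rule bij_betwI[where g="?\<Psi>"])
    show "?\<Psi> (?\<Phi> f) = f" if "f \<in> ind_space \<iota> H G V" for f
      by (rule extensionalityI[where A="carrier G"]) (use that in \<open>auto simp: D inv\<close>)
    show "?\<Phi> (?\<Psi> f) = f" if "f \<in> ind_space \<iota> H G W" for f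
      by (rule extensionalityI[where A="carrier G"]) (use that in \<open>auto simp: D \<psi>\<close>)
  qed (use \<Phi> \<Psi> in auto)
  then show ?thesis
    unfolding rep_iso_def
    using ind_rep_of_representation[OF G \<iota> V] ind_rep_of_representation[OF G \<iota> W]
    by (intro conjI exI[of _ ?\<Phi>]) (auto simp: D add smult \<Phi> cong: restrict_cong)
qed

text \<open>For trivial coefficients, equivariance is invariance under left multiplication by the elements
  \<open>\<iota> h\<close>. The induced representation hence sees only the set of these elements, and representations
  induced along different maps can be compared by an equality of sets.\<close>

lemma ind_triv_image:
  "ind_rep \<iota> H G triv_rep = ind_rep id (G\<lparr>carrier := \<iota> ` carrier H\<rparr>) G triv_rep"
proof -
  have eq: "ind_space \<iota> H G triv_rep = ind_space id (G\<lparr>carrier := \<iota> ` carrier H\<rparr>) G triv_rep"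
    by (auto simp: ind_space_def triv_rep_def)
  show ?thesis unfolding ind_rep_def eq by (simp add: triv_rep_def)
qed

lemma ind_triv_cong:
  assumes "\<iota> ` carrier H = \<kappa> ` carrier K"
  shows "ind_rep \<iota> H G triv_rep = ind_rep \<kappa> K G triv_rep"
  using ind_triv_image[of \<iota> H G] ind_triv_image[of \<kappa> K G] assms by simp

lemma res_representation:
  assumes V: "representation G V" and H: "subgroup H G"
  shows "representation (G\<lparr>carrier := H\<rparr>) (res_rep H V)"
proof -
  note rV = representationD[OF V]
  interpret group G by (rule rV)
  have HG: "h \<in> carrier G" if "h \<in> H" for h using subgroup.mem_carrier[OF H that] .
  have m: "module complex_field (res_rep H V)"
    by (rule complex_moduleI)
      (auto simp: res_rep_def complex_moduleD[OF rV(2)] intro: complex_module_commute[OF rV(2)])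
  show ?thesis
    by (rule representationI[OF subgroup_imp_group[OF H] m])
      (auto simp: res_rep_def HG rV subgroup.m_closed[OF H] subgroup.one_closed[OF H])
qed

section \<open>Mackey's formula for one double coset, and induction in stages\<close>

text \<open>A function on \<open>G = K H\<close> that is invariant under left multiplication by \<open>K\<close> is determined by its
  restriction to \<open>H\<close>. A function on \<open>H\<close> extends to such a function exactly if it is invariant under
  \<open>K \<inter> H\<close>.\<close>

lemma mackey_single_double_coset:
  fixes G :: "'g monoid" (structure)
  assumes G: "group G" and K: "subgroup K G" and H: "subgroup H G"
    and KH: "\<And>g. g \<in> carrier G \<Longrightarrow> \<exists>k\<in>K. \<exists>h\<in>H. g = k \<otimes> h"
  shows "rep_iso (G\<lparr>carrier := H\<rparr>)
    (res_rep H (ind_rep id (G\<lparr>carrier := K\<rparr>) G triv_rep))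
    (ind_rep id (G\<lparr>carrier := K \<inter> H\<rparr>) (G\<lparr>carrier := H\<rparr>) triv_rep)"
    (is "rep_iso ?H (res_rep H ?V) ?W")
proof -
  interpret group G by (rule G)
  have Hg: "group ?H" by (rule subgroup_imp_group[OF H])
  have HG: "\<And>h. h \<in> H \<Longrightarrow> h \<in> carrier G" and KG: "\<And>k. k \<in> K \<Longrightarrow> k \<in> carrier G"
    using subgroup.mem_carrier[OF H] subgroup.mem_carrier[OF K] by auto
  let ?A = "ind_space id (G\<lparr>carrier := K\<rparr>) G triv_rep"
  let ?B = "ind_space id (G\<lparr>carrier := K \<inter> H\<rparr>) ?H triv_rep"
  have A: "f \<in> ?A \<longleftrightarrow> f \<in> extensional (carrier G) \<and> (\<forall>k\<in>K. \<forall>g\<in>carrier G. f (k \<otimes> g) = f g)" for f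
    by (auto simp: ind_space_def triv_rep_def PiE_def)
  have B: "f \<in> ?B \<longleftrightarrow> f \<in> extensional H \<and> (\<forall>k\<in>K \<inter> H. \<forall>h\<in>H. f (k \<otimes> h) = f h)" for f
    by (auto simp: ind_space_def triv_rep_def PiE_def)
  let ?\<phi> = "\<lambda>f. restrict f H"
  have \<phi>: "?\<phi> f \<in> ?B" if "f \<in> ?A" for f
    using that HG subgroup.m_closed[OF H] by (auto simp: A B)
  define part where "part g = (SOME h. h \<in> H \<and> (\<exists>k\<in>K. g = k \<otimes> h))" for g
  have part: "part g \<in> H \<and> (\<exists>k\<in>K. g = k \<otimes> part g)" if "g \<in> carrier G" for g
    unfolding part_def by (rule someI_ex) (use KH[OF that] in blast)
  \<comment> \<open>Two choices of the second factor of \<open>g = k h\<close> differ by an element of \<open>K \<inter> H\<close>.\<close>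
  have unique: "f (part (k \<otimes> h)) = f h" if f: "f \<in> ?B" and k: "k \<in> K" and h: "h \<in> H" for f k h
  proof -
    have "k \<otimes> h \<in> carrier G" using k h HG KG by simp
    then obtain k' where k': "k' \<in> K" "k \<otimes> h = k' \<otimes> part (k \<otimes> h)" and p: "part (k \<otimes> h) \<in> H"
      using part by blast
    define h' where "h' = part (k \<otimes> h)"
    have eq: "k \<otimes> h = k' \<otimes> h'" and h': "h' \<in> H" using k' p by (auto simp: h'_def)
    have c: "k \<in> carrier G" "k' \<in> carrier G" "h \<in> carrier G" "h' \<in> carrier G"
      using k k' h h' HG KG by auto
    have d: "inv k' \<otimes> k = h' \<otimes> inv h"
    proof -
      have "inv k' \<otimes> k = inv k' \<otimes> (k \<otimes> h) \<otimes> inv h" using c by (simp add: m_assoc)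
      also have "\<dots> = h' \<otimes> inv h" unfolding eq using c by (simp add: m_assoc[symmetric])
      finally show ?thesis .
    qed
    have "inv k' \<otimes> k \<in> K" using k k'(1) K by (simp add: subgroup.m_closed subgroup.m_inv_closed)
    moreover have "h' \<otimes> inv h \<in> H"
      using h h' H by (simp add: subgroup.m_closed subgroup.m_inv_closed)
    ultimately have "f ((h' \<otimes> inv h) \<otimes> h) = f h" using f h d by (auto simp: B)
    then show ?thesis using c by (simp add: m_assoc h'_def)
  qed
  let ?\<psi> = "\<lambda>f. \<lambda>g\<in>carrier G. f (part g)"
  have unique1: "f (part h) = f h" if "f \<in> ?B" "h \<in> H" for f h
    using unique[of f \<one> h] subgroup.one_closed[OF K] that HG by simp
  have bij: "bij_betw ?\<phi> ?A ?B"
  proof (rule bij_betwI[where g="?\<psi>"])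
    show "?\<psi> \<in> ?B \<rightarrow> ?A"
    proof
      fix f assume f: "f \<in> ?B"
      have "f (part (k \<otimes> g)) = f (part g)" if "k \<in> K" and g: "g \<in> carrier G" for k g
      proof -
        obtain k' where k': "k' \<in> K" "g = k' \<otimes> part g" and p: "part g \<in> H"
          using part[OF g] by blast
        have "k \<otimes> g = (k \<otimes> k') \<otimes> part g"
          using k' that p HG KG by (metis m_assoc)
        then show ?thesis
          using unique[OF f _ p] that k' subgroup.m_closed[OF K] by metis
      qed
      then show "?\<psi> f \<in> ?A" using KG by (auto simp: A)
    qed
    show "?\<psi> (?\<phi> f) = f" if f: "f \<in> ?A" for f
    proof (rule extensionalityI[where A="carrier G"])
      fix g assume g: "g \<in> carrier G"
      then obtain k where "k \<in> K" "g = k \<otimes> part g" "part g \<in> H" using part by blast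
      then show "?\<psi> (?\<phi> f) g = f g" using f g HG by (auto simp: A) metis
    qed (use f in \<open>auto simp: A\<close>)
    show "?\<phi> (?\<psi> f) = f" if f: "f \<in> ?B" for f
      by (rule extensionalityI[where A=H]) (use f HG unique1[OF f] in \<open>auto simp: B\<close>)
  qed (use \<phi> in auto)
  have "representation G ?V" by (rule ind_triv_representation[OF G]) (use KG in auto)
  then have "representation ?H (res_rep H ?V)" by (rule res_representation[OF _ H])
  then show ?thesis
  proof (rule rep_iso_transport[where \<phi>="?\<phi>"])
    show "bij_betw ?\<phi> (carrier (res_rep H ?V)) (carrier ?W)"
      using bij by (simp add: res_rep_def)
    show "?\<phi> (act (res_rep H ?V) x f) = act ?W x (?\<phi> f)"
      if "x \<in> carrier ?H" "f \<in> carrier (res_rep H ?V)" for x f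
      using that \<phi> HG subgroup.m_closed[OF H] by (auto simp: res_rep_def)
  qed (auto simp: res_rep_def HG)
qed

text \<open>The isomorphism sends \<open>F\<close> to \<open>g \<mapsto> F(g)(1)\<close>, the counit of the inner induction. Equivariance
  gives \<open>F(g)(\<pi> h) = F(\<iota> h g)(1)\<close>, so \<open>F\<close> can be recovered because \<open>\<pi>\<close> is onto. The recovered value is
  independent of the lift \<open>h\<close> because the kernel of \<open>\<pi>\<close> lies in the preimage of \<open>K\<close>.\<close>

lemma ind_stages:
  fixes G :: "'g monoid" and H :: "'h monoid" and L :: "'l monoid"
  assumes G: "group G" and H: "group H" and L: "group L"
    and \<iota>: "\<iota> \<in> hom H G" and \<pi>: "\<pi> \<in> hom H L" and surj: "\<pi> ` carrier H = carrier L"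
    and K: "K \<subseteq> carrier L" "\<one>\<^bsub>L\<^esub> \<in> K"
  shows "rep_iso G
    (ind_rep \<iota> H G (pull_rep \<pi> (ind_rep id (L\<lparr>carrier := K\<rparr>) L triv_rep)))
    (ind_rep \<iota> (H\<lparr>carrier := {h \<in> carrier H. \<pi> h \<in> K}\<rparr>) G triv_rep)"
    (is "rep_iso G ?V ?W")
proof -
  interpret G: group G by (rule G)
  interpret H: group H by (rule H)
  interpret L: group L by (rule L)
  interpret \<iota>: group_hom H G \<iota> using G H \<iota> by (simp add: group_hom_def group_hom_axioms_def)
  interpret \<pi>: group_hom H L \<pi> using L H \<pi> by (simp add: group_hom_def group_hom_axioms_def)
  let ?U = "ind_rep id (L\<lparr>carrier := K\<rparr>) L triv_rep"
  let ?M = "{h \<in> carrier H. \<pi> h \<in> K}"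
  let ?X = "ind_space id (L\<lparr>carrier := K\<rparr>) L triv_rep"
  let ?A = "ind_space \<iota> H G (pull_rep \<pi> ?U)"
  let ?B = "ind_space \<iota> (H\<lparr>carrier := ?M\<rparr>) G triv_rep"
  have U: "representation L ?U" by (rule ind_triv_representation[OF L]) (use K in auto)
  have \<iota>': "\<iota> \<in> carrier H \<rightarrow> carrier G" by auto
  have V: "representation G ?V"
    by (rule ind_rep_of_representation[OF G \<iota>' pull_representation[OF H \<pi> U]])
  have X: "f \<in> ?X \<longleftrightarrow> f \<in> extensional (carrier L) \<and> (\<forall>k\<in>K. \<forall>l\<in>carrier L. f (k \<otimes>\<^bsub>L\<^esub> l) = f l)" for f
    by (auto simp: ind_space_def triv_rep_def PiE_def)
  have B: "f \<in> ?B \<longleftrightarrow> f \<in> extensional (carrier G) \<and>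
      (\<forall>h\<in>?M. \<forall>g\<in>carrier G. f (\<iota> h \<otimes>\<^bsub>G\<^esub> g) = f g)" for f
    by (auto simp: ind_space_def triv_rep_def PiE_def)
  have A_X: "F g \<in> ?X" if "F \<in> ?A" "g \<in> carrier G" for F g
    using ind_spaceD(2)[OF that] by simp
  have A_eq: "F (\<iota> h \<otimes>\<^bsub>G\<^esub> g) l = F g (l \<otimes>\<^bsub>L\<^esub> \<pi> h)"
    if "F \<in> ?A" "h \<in> carrier H" "g \<in> carrier G" "l \<in> carrier L" for F h g l
    using ind_spaceD(3)[OF that(1-3)] A_X[OF that(1,3)] that by simp
  let ?\<phi> = "\<lambda>F. \<lambda>g\<in>carrier G. F g \<one>\<^bsub>L\<^esub>"
  have \<phi>: "?\<phi> F \<in> ?B" if F: "F \<in> ?A" for F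
  proof -
    have "F (\<iota> h \<otimes>\<^bsub>G\<^esub> g) \<one>\<^bsub>L\<^esub> = F g \<one>\<^bsub>L\<^esub>" if "h \<in> ?M" "g \<in> carrier G" for h g
    proof -
      have "F (\<iota> h \<otimes>\<^bsub>G\<^esub> g) \<one>\<^bsub>L\<^esub> = F g (\<pi> h \<otimes>\<^bsub>L\<^esub> \<one>\<^bsub>L\<^esub>)"
        using A_eq[OF F _ that(2), of h "\<one>\<^bsub>L\<^esub>"] that by simp
      also have "\<dots> = F g \<one>\<^bsub>L\<^esub>"
        using A_X[OF F that(2)] that L.one_closed unfolding X by blast
      finally show ?thesis .
    qed
    then show ?thesis by (auto simp: B)
  qed
  define lift where "lift l = (SOME h. h \<in> carrier H \<and> \<pi> h = l)" for l
  have lift: "lift l \<in> carrier H" "\<pi> (lift l) = l" if "l \<in> carrier L" for l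
  proof -
    have "l \<in> \<pi> ` carrier H" using surj that by simp
    then have "\<exists>h. h \<in> carrier H \<and> \<pi> h = l" by blast
    from someI_ex[OF this] show "lift l \<in> carrier H" "\<pi> (lift l) = l" by (auto simp: lift_def)
  qed
  \<comment> \<open>Two lifts of \<open>k l\<close> and \<open>l\<close> with \<open>k \<in> K\<close> differ on the left by an element over \<open>k\<close>.\<close>
  have lift_eq: "f (\<iota> (lift l) \<otimes>\<^bsub>G\<^esub> g) = f (\<iota> h \<otimes>\<^bsub>G\<^esub> g)"
    if f: "f \<in> ?B" and h: "h \<in> carrier H" and k: "k \<in> K" and l: "l = k \<otimes>\<^bsub>L\<^esub> \<pi> h"
      and g: "g \<in> carrier G" for f l h k g
  proof -
    have kL: "k \<in> carrier L" and lL: "l \<in> carrier L" using k h K l by auto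
    let ?d = "lift l \<otimes>\<^bsub>H\<^esub> inv\<^bsub>H\<^esub> h"
    have d: "?d \<in> ?M" using h k kL lift[OF lL] by (simp add: l L.m_assoc)
    have "\<iota> (lift l) \<otimes>\<^bsub>G\<^esub> g = \<iota> ?d \<otimes>\<^bsub>G\<^esub> (\<iota> h \<otimes>\<^bsub>G\<^esub> g)"
      using h g lift[OF lL] by (simp add: G.m_assoc flip: G.m_assoc[of "inv\<^bsub>G\<^esub> \<iota> h" "\<iota> h" g])
    moreover have "\<iota> h \<otimes>\<^bsub>G\<^esub> g \<in> carrier G" using h g by simp
    ultimately show ?thesis using f d unfolding B by metis
  qed
  let ?\<psi> = "\<lambda>f. \<lambda>g\<in>carrier G. \<lambda>l\<in>carrier L. f (\<iota> (lift l) \<otimes>\<^bsub>G\<^esub> g)"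
  have lift1: "f (\<iota> (lift (\<pi> h)) \<otimes>\<^bsub>G\<^esub> g) = f (\<iota> h \<otimes>\<^bsub>G\<^esub> g)"
    if "f \<in> ?B" "h \<in> carrier H" "g \<in> carrier G" for f h g
    by (rule lift_eq[OF that(1,2) K(2) _ that(3)]) (use that in simp)
  have bij: "bij_betw ?\<phi> ?A ?B"
  proof (rule bij_betwI[where g="?\<psi>"])
    show "?\<psi> \<in> ?B \<rightarrow> ?A"
    proof
      fix f assume f: "f \<in> ?B"
      have psiX: "?\<psi> f g \<in> ?X" if "g \<in> carrier G" for g
      proof -
        have "f (\<iota> (lift (k \<otimes>\<^bsub>L\<^esub> l)) \<otimes>\<^bsub>G\<^esub> g) = f (\<iota> (lift l) \<otimes>\<^bsub>G\<^esub> g)"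
          if "k \<in> K" "l \<in> carrier L" for k l
          using lift_eq[OF f _ that(1) _ \<open>g \<in> carrier G\<close>, of "lift l"] lift that by simp
        then show ?thesis using that K by (auto simp: X)
      qed
      show "?\<psi> f \<in> ?A"
      proof (rule ind_spaceI)
        fix h g assume h: "h \<in> carrier H" and g: "g \<in> carrier G"
        have "f (\<iota> (lift l) \<otimes>\<^bsub>G\<^esub> (\<iota> h \<otimes>\<^bsub>G\<^esub> g)) = f (\<iota> (lift (l \<otimes>\<^bsub>L\<^esub> \<pi> h)) \<otimes>\<^bsub>G\<^esub> g)"
          if l: "l \<in> carrier L" for l
          using lift1[OF f _ g, of "lift l \<otimes>\<^bsub>H\<^esub> h"] lift[OF l] h g by (simp add: G.m_assoc)
        then show "?\<psi> f (\<iota> h \<otimes>\<^bsub>G\<^esub> g) = act (pull_rep \<pi> ?U) h (?\<psi> f g)"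
          using psiX[OF g] h g by (auto intro!: restrict_ext)
      qed (use psiX in auto)
    qed
    show "?\<psi> (?\<phi> F) = F" if F: "F \<in> ?A" for F
    proof (rule extensionalityI[where A="carrier G"])
      fix g assume g: "g \<in> carrier G"
      show "?\<psi> (?\<phi> F) g = F g"
      proof (rule extensionalityI[where A="carrier L"])
        show "?\<psi> (?\<phi> F) g l = F g l" if "l \<in> carrier L" for l
          using that g lift[OF that] A_eq[OF F _ g, of "lift l" "\<one>\<^bsub>L\<^esub>"] by simp
        show "F g \<in> extensional (carrier L)" using A_X[OF F g] unfolding X by blast
      qed (simp add: g)
    qed (simp_all add: ind_spaceD(1)[OF F])
    show "?\<phi> (?\<psi> f) = f" if f: "f \<in> ?B" for f
    proof (rule extensionalityI[where A="carrier G"])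
      show "?\<phi> (?\<psi> f) g = f g" if "g \<in> carrier G" for g
        using lift1[OF f H.one_closed that] that by simp
    qed (simp_all add: ind_spaceD(1)[OF f])
    show "?\<phi> \<in> ?A \<rightarrow> ?B" using \<phi> by blast
  qed
  from V show ?thesis
  proof (rule rep_iso_transport[where \<phi>="?\<phi>"])
    show "bij_betw ?\<phi> (carrier ?V) (carrier ?W)" using bij by simp
    show "?\<phi> (act ?V x F) = act ?W x (?\<phi> F)"
      if "x \<in> carrier G" "F \<in> carrier ?V" for x F
      using that \<phi>[of F] by (simp cong: restrict_cong)
    show "\<zero>\<^bsub>?W\<^esub> = ?\<phi> \<zero>\<^bsub>?V\<^esub>" by (simp add: triv_rep_def cong: restrict_cong)
    show "?\<phi> (F \<oplus>\<^bsub>?V\<^esub> F') = ?\<phi> F \<oplus>\<^bsub>?W\<^esub> ?\<phi> F'" for F F'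
      by (simp add: triv_rep_def cong: restrict_cong)
    show "?\<phi> (c \<odot>\<^bsub>?V\<^esub> F) = c \<odot>\<^bsub>?W\<^esub> ?\<phi> F" for c F
      by (simp add: triv_rep_def cong: restrict_cong)
    show "act ?W x \<in> extensional (carrier ?W)" for x by simp
  qed
qed

section \<open>Free modules and their quotients\<close>

lemma lookup_map_times [simp]:
  "Poly_Mapping.lookup (Poly_Mapping.map ((*) c) f) x = c * Poly_Mapping.lookup (f :: 'x \<Rightarrow>\<^sub>0 complex) x"
  by (simp add: map.rep_eq when_def)

lemma keys_map_times: "Poly_Mapping.keys (Poly_Mapping.map ((*) c) (f :: 'x \<Rightarrow>\<^sub>0 complex)) \<subseteq> Poly_Mapping.keys f"
  by (auto simp: in_keys_iff)

lemma sum_monomials: "(\<Sum>x\<in>Poly_Mapping.keys f. Poly_Mapping.single x (Poly_Mapping.lookup f x)) = f"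
proof (rule poly_mapping_eqI)
  fix y
  show "Poly_Mapping.lookup (\<Sum>x\<in>Poly_Mapping.keys f. Poly_Mapping.single x (Poly_Mapping.lookup f x)) y
      = Poly_Mapping.lookup f y"
    by (cases "y \<in> Poly_Mapping.keys f")
      (auto simp: lookup_sum lookup_single when_def in_keys_iff)
qed

lemma finitely_supported_induct [consumes 1, case_names zero single add]:
  fixes f :: "'x \<Rightarrow>\<^sub>0 complex"
  assumes "Poly_Mapping.keys f \<subseteq> B" and zero: "P 0"
    and single: "\<And>x c. x \<in> B \<Longrightarrow> P (Poly_Mapping.single x c)"
    and add: "\<And>f f'. \<lbrakk>P f; P f'\<rbrakk> \<Longrightarrow> P (f + f')"
  shows "P f"
proof -
  have "P (\<Sum>x\<in>S. Poly_Mapping.single x (Poly_Mapping.lookup f x))"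
    if "finite S" "S \<subseteq> B" for S
    using that by (induction S rule: finite_induct) (auto intro: zero single add)
  then show ?thesis using sum_monomials[of f] assms(1) by (metis finite_keys)
qed

lemma free_map_single: "free_map \<phi> (Poly_Mapping.single x c) = Poly_Mapping.single (\<phi> x) c"
  by (simp add: free_map_def)

lemma free_map_add: "free_map \<phi> (f + g) = free_map \<phi> f + free_map \<phi> g"
  unfolding free_map_def by (rule setsum_keys_plus_distrib) (auto simp: single_add)

lemma free_map_zero: "free_map \<phi> 0 = 0"
  by (simp add: free_map_def)

lemma free_map_diff: "free_map \<phi> (f - g) = free_map \<phi> f - free_map \<phi> g"
  using free_map_add[of \<phi> "f - g" g] by (simp add: algebra_simps)

lemma map_times_add:
  "Poly_Mapping.map ((*) c) (f + g) = Poly_Mapping.map ((*) c) f + Poly_Mapping.map ((*) c) (g :: 'x \<Rightarrow>\<^sub>0 complex)"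
  by (rule poly_mapping_eqI) (simp add: lookup_add algebra_simps)

lemma map_times_diff:
  "Poly_Mapping.map ((*) c) (f - g) = Poly_Mapping.map ((*) c) f - Poly_Mapping.map ((*) c) (g :: 'x \<Rightarrow>\<^sub>0 complex)"
  by (rule poly_mapping_eqI) (simp add: lookup_minus algebra_simps)

lemma map_times_single:
  "Poly_Mapping.map ((*) c) (Poly_Mapping.single x d) = Poly_Mapping.single x (c * d :: complex)"
  by (rule poly_mapping_eqI) (simp add: lookup_single when_def)

lemma map_times_zero: "Poly_Mapping.map ((*) c) 0 = (0 :: 'x \<Rightarrow>\<^sub>0 complex)"
  by (rule poly_mapping_eqI) simp

lemma free_map_smult:
  "free_map \<phi> (Poly_Mapping.map ((*) c) f) = Poly_Mapping.map ((*) c) (free_map \<phi> f)"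
  using subset_UNIV[of "Poly_Mapping.keys f"]
proof (induction f rule: finitely_supported_induct)
  case zero
  then show ?case by (simp add: free_map_zero map_times_zero)
qed (simp_all add: free_map_single free_map_add map_times_add map_times_single)

lemma free_map_left_inverse:
  assumes "Poly_Mapping.keys f \<subseteq> B" "\<And>x. x \<in> B \<Longrightarrow> \<psi> (\<phi> x) = x"
  shows "free_map \<psi> (free_map \<phi> f) = f"
  using assms(1)
  by (induction f rule: finitely_supported_induct)
    (simp_all add: free_map_single free_map_add free_map_zero assms(2))

lemma free_module_sel [simp]:
  "carrier (free_module B) = {f. Poly_Mapping.keys f \<subseteq> B}" "\<zero>\<^bsub>free_module B\<^esub> = 0"
  "f \<oplus>\<^bsub>free_module B\<^esub> g = f + g" "c \<odot>\<^bsub>free_module B\<^esub> f = Poly_Mapping.map ((*) c) f"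
  by (simp_all add: free_module_def)

lemma free_module_module: "module complex_field (free_module B)"
proof (rule complex_moduleI)
  show "f \<oplus>\<^bsub>free_module B\<^esub> g \<in> carrier (free_module B)"
    if "f \<in> carrier (free_module B)" "g \<in> carrier (free_module B)" for f g
    using that keys_add[of f g] by auto
  show "c \<odot>\<^bsub>free_module B\<^esub> f \<in> carrier (free_module B)"
    if "f \<in> carrier (free_module B)" for c f
    using that keys_map_times[of c f] by auto
qed (auto intro!: poly_mapping_eqI simp: lookup_add algebra_simps)

abbreviation free_span :: "'x set \<Rightarrow> ('x \<Rightarrow>\<^sub>0 complex) set \<Rightarrow> ('x \<Rightarrow>\<^sub>0 complex) set" where
  "free_span B R \<equiv> (\<lambda>N. submodule N complex_field (free_module B)) hull R"

text \<open>Negation is multiplication by \<open>-1\<close>, so a submodule over the complex numbers is characterized by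
  closure under addition and scalars, in the plain operations on finitely supported functions.\<close>

lemma free_submodule_iff:
  "submodule N complex_field (free_module B) \<longleftrightarrow> N \<subseteq> {f. Poly_Mapping.keys f \<subseteq> B} \<and> 0 \<in> N \<and>
    (\<forall>f\<in>N. \<forall>g\<in>N. f + g \<in> N) \<and> (\<forall>c. \<forall>f\<in>N. Poly_Mapping.map ((*) c) f \<in> N)"
    (is "?l \<longleftrightarrow> ?r")
proof -
  interpret module complex_field "free_module B" by (rule free_module_module)
  show ?thesis
  proof
    assume ?l
    then interpret submodule N complex_field "free_module B" .
    show ?r using subset m_closed one_closed smult_closed by auto
  next
    assume r: ?r
    have "\<ominus>\<^bsub>free_module B\<^esub> f = Poly_Mapping.map ((*) (-1)) f" if "f \<in> N" for f
    proof -
      have "Poly_Mapping.map ((*) (-1)) f + f = 0" by (rule poly_mapping_eqI) (simp add: lookup_add)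
      moreover have "Poly_Mapping.map ((*) (-1)) f \<in> N" using that r by blast
      then have "f \<in> carrier (free_module B)" "Poly_Mapping.map ((*) (-1)) f \<in> carrier (free_module B)"
        using that r unfolding free_module_sel by blast+
      ultimately show ?thesis by (intro minus_equality) simp_all
    qed
    then show ?l using r by (intro submoduleI) auto
  qed
qed

lemma free_span_closed:
  assumes "R \<subseteq> {f. Poly_Mapping.keys f \<subseteq> B}"
  shows "R \<subseteq> free_span B R" "free_span B R \<subseteq> {f. Poly_Mapping.keys f \<subseteq> B}" "0 \<in> free_span B R"
    and "\<And>f g. \<lbrakk>f \<in> free_span B R; g \<in> free_span B R\<rbrakk> \<Longrightarrow> f + g \<in> free_span B R"
    and "\<And>f g. \<lbrakk>f \<in> free_span B R; g \<in> free_span B R\<rbrakk> \<Longrightarrow> f - g \<in> free_span B R"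
    and "\<And>c f. f \<in> free_span B R \<Longrightarrow> Poly_Mapping.map ((*) c) f \<in> free_span B R"
proof -
  have univ: "submodule {f. Poly_Mapping.keys f \<subseteq> B} complex_field (free_module B)"
    using module.carrier_is_submodule[OF free_module_module[of B]] by simp
  have sub: "submodule (free_span B R) complex_field (free_module B)"
  proof (rule iffD2[OF free_submodule_iff], intro conjI ballI allI)
    show "free_span B R \<subseteq> {f. Poly_Mapping.keys f \<subseteq> B}"
      using assms univ by (rule hull_minimal)
  qed (auto simp: hull_def free_submodule_iff)
  note c = iffD1[OF free_submodule_iff sub]
  show "R \<subseteq> free_span B R" by (rule hull_subset)
  show "free_span B R \<subseteq> {f. Poly_Mapping.keys f \<subseteq> B}" "0 \<in> free_span B R" using c by auto
  show "f + g \<in> free_span B R" if "f \<in> free_span B R" "g \<in> free_span B R" for f g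
    using c that by blast
  show smult: "Poly_Mapping.map ((*) a) f \<in> free_span B R" if "f \<in> free_span B R" for a f
    using c that by blast
  show "f - g \<in> free_span B R" if "f \<in> free_span B R" "g \<in> free_span B R" for f g
  proof -
    have "f - g = f + Poly_Mapping.map ((*) (-1)) g"
      by (rule poly_mapping_eqI) (simp add: lookup_add lookup_minus)
    moreover have "f + Poly_Mapping.map ((*) (-1)) g \<in> free_span B R"
      using c smult[OF that(2)] that(1) by blast
    ultimately show ?thesis by (rule ssubst)
  qed
qed

lemma free_span_minimal:
  assumes "R \<subseteq> S" "S \<subseteq> {f. Poly_Mapping.keys f \<subseteq> B}" "0 \<in> S"
    and "\<And>f g. \<lbrakk>f \<in> S; g \<in> S\<rbrakk> \<Longrightarrow> f + g \<in> S"
    and "\<And>c f. f \<in> S \<Longrightarrow> Poly_Mapping.map ((*) c) f \<in> S"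
  shows "free_span B R \<subseteq> S"
  by (rule hull_minimal) (use assms in \<open>auto simp: free_submodule_iff\<close>)

text \<open>The cosets of a submodule of a free module, written with the plain addition of finitely
  supported functions: the basis \<open>B\<close> enters only through the choice of \<open>N\<close> and \<open>f\<close>.\<close>

definition coset :: "('x \<Rightarrow>\<^sub>0 complex) set \<Rightarrow> ('x \<Rightarrow>\<^sub>0 complex) \<Rightarrow> ('x \<Rightarrow>\<^sub>0 complex) set" where
  "coset N f = (\<lambda>a. a + f) ` N"

lemma in_coset: "g \<in> coset N f \<longleftrightarrow> g - f \<in> N"
  unfolding coset_def by (auto simp: image_iff intro: bexI[of _ "g - f"])

lemma quotient_free_module:
  fixes R :: "('x \<Rightarrow>\<^sub>0 complex) set" and B :: "'x set"
  assumes R: "R \<subseteq> {f. Poly_Mapping.keys f \<subseteq> B}"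
  defines "N \<equiv> free_span B R" and "Q \<equiv> quotient_module (free_module B) (free_span B R)"
  shows "carrier Q = coset N ` {f. Poly_Mapping.keys f \<subseteq> B}"
    and "zero Q = coset N 0"
    and "coset N f \<oplus>\<^bsub>Q\<^esub> coset N g = coset N (f + g)"
    and "c \<odot>\<^bsub>Q\<^esub> coset N f = coset N (Poly_Mapping.map ((*) c) f)"
    and "coset N f = coset N g \<longleftrightarrow> f - g \<in> N"
proof -
  note cl = free_span_closed[OF R, folded N_def]
  have rc: "N +>\<^bsub>free_module B\<^esub> f = coset N f" for f
    by (auto simp: a_r_coset_def' coset_def)
  show "carrier Q = coset N ` {f. Poly_Mapping.keys f \<subseteq> B}"
    by (auto simp: Q_def quotient_module_def A_RCOSETS_def' rc simp flip: N_def)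
  show "zero Q = coset N 0"
    by (simp add: Q_def quotient_module_def coset_def flip: N_def)
  show eq: "coset N f = coset N g \<longleftrightarrow> f - g \<in> N" for f g
  proof
    assume "coset N f = coset N g"
    moreover have "f \<in> coset N f" using cl(3) by (simp add: in_coset)
    ultimately show "f - g \<in> N" by (simp add: in_coset)
  next
    assume fg: "f - g \<in> N"
    show "coset N f = coset N g"
    proof (rule Set.set_eqI)
      fix h
      show "h \<in> coset N f \<longleftrightarrow> h \<in> coset N g"
        using cl(4)[OF _ fg, of "h - f"] cl(5)[OF _ fg, of "h - g"] by (auto simp: in_coset)
    qed
  qed
  show "coset N f \<oplus>\<^bsub>Q\<^esub> coset N g = coset N (f + g)"
  proof -
    have "coset N f \<oplus>\<^bsub>Q\<^esub> coset N g = {a + b | a b. a \<in> coset N f \<and> b \<in> coset N g}"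
      by (auto simp: Q_def quotient_module_def set_add_def')
    also have "\<dots> = coset N (f + g)"
    proof (rule Set.set_eqI, rule iffI)
      fix h assume "h \<in> {a + b | a b. a \<in> coset N f \<and> b \<in> coset N g}"
      then obtain a b where "h = a + b" "a - f \<in> N" "b - g \<in> N" unfolding in_coset by auto
      then show "h \<in> coset N (f + g)" unfolding in_coset
        using cl(4)[of "a - f" "b - g"] by (simp add: add_diff_add)
    next
      fix h assume "h \<in> coset N (f + g)"
      then have "h - g \<in> coset N f" by (simp add: in_coset diff_diff_eq add.commute)
      moreover have "g \<in> coset N g" using cl(3) by (simp add: in_coset)
      moreover have "h = (h - g) + g" by simp
      ultimately show "h \<in> {a + b | a b. a \<in> coset N f \<and> b \<in> coset N g}" by blast
    qed
    finally show ?thesis .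
  qed
  show "c \<odot>\<^bsub>Q\<^esub> coset N f = coset N (Poly_Mapping.map ((*) c) f)"
  proof -
    have "c \<odot>\<^bsub>Q\<^esub> coset N f = (\<Union>a\<in>coset N f. coset N (Poly_Mapping.map ((*) c) a))"
      by (simp add: Q_def quotient_module_def rc flip: N_def)
    moreover have "coset N (Poly_Mapping.map ((*) c) a) = coset N (Poly_Mapping.map ((*) c) f)"
      if "a \<in> coset N f" for a
      using that cl(6)[of "a - f" c] by (simp add: eq in_coset map_times_diff)
    moreover have "f \<in> coset N f" using cl(3) by (simp add: in_coset)
    ultimately show ?thesis by blast
  qed
qed

section \<open>External tensor product with a trivial representation\<close>

text \<open>The linear extension of \<open>(v, w) \<mapsto> w v\<close>, which induces the contraction
  \<open>V \<otimes> \<complex> \<rightarrow> V\<close>.\<close>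

definition tensor_eval :: "(complex, 'v, 'b) module_scheme \<Rightarrow> ('v \<times> complex \<Rightarrow>\<^sub>0 complex) \<Rightarrow> 'v" where
  "tensor_eval V f = (\<Oplus>\<^bsub>V\<^esub>x\<in>Poly_Mapping.keys f. (Poly_Mapping.lookup f x * snd x) \<odot>\<^bsub>V\<^esub> fst x)"

text \<open>Formal sums with different supports can be compared after both are summed over a common finite
  superset.\<close>

lemma tensor_eval_superset:
  assumes "module complex_field V" "finite S" "Poly_Mapping.keys f \<subseteq> S" "S \<subseteq> carrier V \<times> UNIV"
  shows "tensor_eval V f = (\<Oplus>\<^bsub>V\<^esub>x\<in>S. (Poly_Mapping.lookup f x * snd x) \<odot>\<^bsub>V\<^esub> fst x)"
proof -
  interpret module complex_field V by fact
  note m = complex_moduleD[OF assms(1)]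
  show ?thesis
    unfolding tensor_eval_def
    by (rule M.add.finprod_mono_neutral_cong_left)
      (use assms in \<open>auto simp: in_keys_iff m\<close>)
qed

lemma tensor_eval_add:
  assumes V: "module complex_field V"
    and f: "Poly_Mapping.keys f \<subseteq> carrier V \<times> UNIV" and g: "Poly_Mapping.keys g \<subseteq> carrier V \<times> UNIV"
  shows "tensor_eval V (f + g) = tensor_eval V f \<oplus>\<^bsub>V\<^esub> tensor_eval V g"
proof -
  interpret module complex_field V by fact
  note m = complex_moduleD[OF V]
  let ?S = "Poly_Mapping.keys f \<union> Poly_Mapping.keys g"
  have S: "finite ?S" "?S \<subseteq> carrier V \<times> UNIV" using f g by auto
  have "tensor_eval V (f + g) = (\<Oplus>\<^bsub>V\<^esub>x\<in>?S. (Poly_Mapping.lookup (f + g) x * snd x) \<odot>\<^bsub>V\<^esub> fst x)"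
    by (rule tensor_eval_superset[OF V]) (use S keys_add[of f g] in auto)
  also have "\<dots> = (\<Oplus>\<^bsub>V\<^esub>x\<in>?S. (Poly_Mapping.lookup f x * snd x) \<odot>\<^bsub>V\<^esub> fst x \<oplus>\<^bsub>V\<^esub>
      (Poly_Mapping.lookup g x * snd x) \<odot>\<^bsub>V\<^esub> fst x)"
    by (rule M.finsum_cong') (use S in \<open>auto simp: lookup_add distrib_right m\<close>)
  also have "\<dots> = (\<Oplus>\<^bsub>V\<^esub>x\<in>?S. (Poly_Mapping.lookup f x * snd x) \<odot>\<^bsub>V\<^esub> fst x) \<oplus>\<^bsub>V\<^esub>
      (\<Oplus>\<^bsub>V\<^esub>x\<in>?S. (Poly_Mapping.lookup g x * snd x) \<odot>\<^bsub>V\<^esub> fst x)"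
    by (rule M.finsum_addf) (use S in \<open>auto simp: m\<close>)
  also have "\<dots> = tensor_eval V f \<oplus>\<^bsub>V\<^esub> tensor_eval V g"
    using tensor_eval_superset[OF V S(1) _ S(2), of f] tensor_eval_superset[OF V S(1) _ S(2), of g]
    by simp
  finally show ?thesis .
qed

lemma tensor_eval_smult:
  assumes V: "module complex_field V" and f: "Poly_Mapping.keys f \<subseteq> carrier V \<times> UNIV"
  shows "tensor_eval V (Poly_Mapping.map ((*) c) f) = c \<odot>\<^bsub>V\<^esub> tensor_eval V f"
proof -
  interpret module complex_field V by fact
  note m = complex_moduleD[OF V]
  let ?S = "Poly_Mapping.keys f"
  have "tensor_eval V (Poly_Mapping.map ((*) c) f)
      = (\<Oplus>\<^bsub>V\<^esub>x\<in>?S. (Poly_Mapping.lookup (Poly_Mapping.map ((*) c) f) x * snd x) \<odot>\<^bsub>V\<^esub> fst x)"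
    by (rule tensor_eval_superset[OF V _ keys_map_times f]) simp
  also have "\<dots> = (\<Oplus>\<^bsub>V\<^esub>x\<in>?S. c \<odot>\<^bsub>V\<^esub> ((Poly_Mapping.lookup f x * snd x) \<odot>\<^bsub>V\<^esub> fst x))"
    by (rule M.finsum_cong') (use f in \<open>auto simp: mult.assoc m\<close>)
  also have "\<dots> = c \<odot>\<^bsub>V\<^esub> tensor_eval V f"
    unfolding tensor_eval_def by (rule finsum_smult_ldistr[symmetric]) (use f in \<open>auto simp: m\<close>)
  finally show ?thesis .
qed

lemma tensor_eval_single:
  assumes V: "module complex_field V" and v: "v \<in> carrier V"
  shows "tensor_eval V (Poly_Mapping.single (v, w) c) = (c * w) \<odot>\<^bsub>V\<^esub> v"
proof -
  interpret module complex_field V by fact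
  have "tensor_eval V (Poly_Mapping.single (v, w) c)
    = (\<Oplus>\<^bsub>V\<^esub>x\<in>{(v, w)}. (Poly_Mapping.lookup (Poly_Mapping.single (v, w) c) x * snd x) \<odot>\<^bsub>V\<^esub> fst x)"
    by (rule tensor_eval_superset[OF V]) (use v in auto)
  then show ?thesis using v by (simp add: complex_moduleD[OF V])
qed

lemma tensor_eval_closed:
  assumes V: "module complex_field V" and f: "Poly_Mapping.keys f \<subseteq> carrier V \<times> UNIV"
  shows "tensor_eval V f \<in> carrier V"
proof -
  interpret module complex_field V by fact
  show ?thesis unfolding tensor_eval_def by (rule M.finsum_closed) (use f in \<open>auto simp: complex_moduleD[OF V]\<close>)
qed

lemma triv_rep_sel [simp]:
  "carrier triv_rep = UNIV" "zero triv_rep = 0" "v \<oplus>\<^bsub>triv_rep\<^esub> w = v + w"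
  "c \<odot>\<^bsub>triv_rep\<^esub> v = c * v" "act triv_rep g = id"
  by (simp_all add: triv_rep_def)

lemma bilinear_relators_triv:
  fixes V :: "('g, 'v) rep"
  shows "bilinear_relators V (triv_rep :: ('h, complex) rep) =
   {Poly_Mapping.single (v \<oplus>\<^bsub>V\<^esub> v', w) 1 - Poly_Mapping.single (v, w) 1 - Poly_Mapping.single (v', w) 1
      | v v' w. v \<in> carrier V \<and> v' \<in> carrier V} \<union>
   {Poly_Mapping.single (v, w + w') 1 - Poly_Mapping.single (v, w) 1 - Poly_Mapping.single (v, w') 1
      | v w w'. v \<in> carrier V} \<union>
   {Poly_Mapping.single (c \<odot>\<^bsub>V\<^esub> v, w) 1 - Poly_Mapping.single (v, w) c | c v w. v \<in> carrier V} \<union>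
   {Poly_Mapping.single (v, c * w) 1 - Poly_Mapping.single (v, w) c | c v w. v \<in> carrier V}"
  by (simp add: bilinear_relators_def Let_def)

lemma keys_diff_subset:
  "Poly_Mapping.keys f \<subseteq> B \<Longrightarrow> Poly_Mapping.keys g \<subseteq> B \<Longrightarrow> Poly_Mapping.keys (f - g :: 'x \<Rightarrow>\<^sub>0 complex) \<subseteq> B"
  using keys_diff[of f g] by blast

lemma bilinear_relators_keys:
  fixes V :: "('g, 'v) rep"
  assumes "module complex_field V"
  shows "bilinear_relators V (triv_rep :: ('h, complex) rep) \<subseteq> {f. Poly_Mapping.keys f \<subseteq> carrier V \<times> UNIV}"
proof (rule subsetI, rule CollectI)
  fix r assume "r \<in> bilinear_relators V (triv_rep :: ('h, complex) rep)"
  then show "Poly_Mapping.keys r \<subseteq> carrier V \<times> UNIV"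
    unfolding bilinear_relators_triv
    by (elim UnE CollectE exE conjE; simp only:; intro keys_diff_subset)
      (simp_all add: complex_moduleD[OF assms])
qed

lemma bilinear_relators_triv_cases [consumes 1, case_names add_left add_right smult_left smult_right]:
  fixes V :: "('g, 'v) rep"
  assumes "r \<in> bilinear_relators V (triv_rep :: ('h, complex) rep)"
  obtains v v' w where "v \<in> carrier V" "v' \<in> carrier V"
      "r = Poly_Mapping.single (v \<oplus>\<^bsub>V\<^esub> v', w) 1 - Poly_Mapping.single (v, w) 1 - Poly_Mapping.single (v', w) 1"
    | v w w' where "v \<in> carrier V"
      "r = Poly_Mapping.single (v, w + w') 1 - Poly_Mapping.single (v, w) 1 - Poly_Mapping.single (v, w') 1"
    | c v w where "v \<in> carrier V"
      "r = Poly_Mapping.single (c \<odot>\<^bsub>V\<^esub> v, w) 1 - Poly_Mapping.single (v, w) c"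
    | c v w where "v \<in> carrier V"
      "r = Poly_Mapping.single (v, c * w) 1 - Poly_Mapping.single (v, w) c"
  using assms unfolding bilinear_relators_triv by blast

text \<open>The isomorphism sends \<open>v\<close> to \<open>v \<otimes> 1\<close>. It is injective because the contraction
  \<open>v \<otimes> w \<mapsto> w v\<close> is well defined on the quotient. It is surjective because every \<open>v \<otimes> w\<close> equals
  \<open>w v \<otimes> 1\<close>. The group acts on cosets since its action on formal sums maps relators to relators, and
  the inverse group element shows that the image of a coset is a whole coset.\<close>

lemma external_tensor_triv:
  fixes V :: "('g, 'v) rep" and G :: "'g monoid" (structure) and H :: "'h monoid"
  assumes V: "representation G V" and H: "group H"
  shows "rep_iso (G \<times>\<times> H) (pull_rep fst V) (external_tensor V triv_rep)"
proof -
  note rV = representationD[OF V]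
  note m = complex_moduleD[OF rV(2)]
  interpret group G by (rule rV(1))
  let ?B = "carrier V \<times> (UNIV :: complex set)"
  let ?R = "bilinear_relators V (triv_rep :: ('h, complex) rep)"
  let ?T = "external_tensor V (triv_rep :: ('h, complex) rep)"
  define N where "N = free_span ?B ?R"
  have R: "?R \<subseteq> {f. Poly_Mapping.keys f \<subseteq> ?B}" by (rule bilinear_relators_keys[OF rV(2)])
  note N = free_span_closed[OF R, folded N_def]
  note Q = quotient_free_module[OF R, folded N_def]
  have T_mod: "tensor_module V (triv_rep :: ('h, complex) rep) = quotient_module (free_module ?B) N"
    by (simp add: tensor_module_def N_def Let_def)
  have T: "carrier ?T = carrier (quotient_module (free_module ?B) N)"
    "zero ?T = zero (quotient_module (free_module ?B) N)"
    "add ?T = add (quotient_module (free_module ?B) N)"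
    "module.smult ?T = module.smult (quotient_module (free_module ?B) N)"
    "act ?T = (\<lambda>(g, h). \<lambda>A\<in>carrier (quotient_module (free_module ?B) N).
        free_map (map_prod (act V g) id) ` A)"
    unfolding external_tensor_def T_mod
    by (simp_all add: module.defs rep.defs)
  let ?e = "\<lambda>v. Poly_Mapping.single (v, 1::complex) (1::complex)"
  let ?\<phi> = "\<lambda>v. coset N (?e v)"
  have e: "Poly_Mapping.keys (?e v) \<subseteq> ?B" if "v \<in> carrier V" for v using that by simp
  \<comment> \<open>The evaluation is additive and kills the relators (\<open>eval_N\<close>), so it separates distinct \<open>v \<otimes> 1\<close>.\<close>
  have eval_diff: "tensor_eval V (f - g) = tensor_eval V f \<oplus>\<^bsub>V\<^esub> (-1) \<odot>\<^bsub>V\<^esub> tensor_eval V g"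
    if "Poly_Mapping.keys f \<subseteq> ?B" "Poly_Mapping.keys g \<subseteq> ?B" for f g
  proof -
    have eq: "f - g = f + Poly_Mapping.map ((*) (-1)) g"
      by (rule poly_mapping_eqI) (simp add: lookup_add lookup_minus)
    have "Poly_Mapping.keys (Poly_Mapping.map ((*) (-1)) g) \<subseteq> ?B"
      using keys_map_times that(2) by (rule subset_trans)
    then show ?thesis
      unfolding eq by (simp only: tensor_eval_add[OF rV(2) that(1)] tensor_eval_smult[OF rV(2) that(2)])
  qed
  have cancel: "v \<oplus>\<^bsub>V\<^esub> (-1) \<odot>\<^bsub>V\<^esub> w = \<zero>\<^bsub>V\<^esub> \<longleftrightarrow> v = w" if "v \<in> carrier V" "w \<in> carrier V" for v w
  proof -
    have neg: "(-1) \<odot>\<^bsub>V\<^esub> w \<oplus>\<^bsub>V\<^esub> w = \<zero>\<^bsub>V\<^esub>" "w \<oplus>\<^bsub>V\<^esub> (-1) \<odot>\<^bsub>V\<^esub> w = \<zero>\<^bsub>V\<^esub>"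
      using m(6)[OF that(2), of "-1" 1] m(6)[OF that(2), of 1 "-1"] m(9,10)[OF that(2)] by simp_all
    have "v = w" if 0: "v \<oplus>\<^bsub>V\<^esub> (-1) \<odot>\<^bsub>V\<^esub> w = \<zero>\<^bsub>V\<^esub>"
    proof -
      have "v = v \<oplus>\<^bsub>V\<^esub> ((-1) \<odot>\<^bsub>V\<^esub> w \<oplus>\<^bsub>V\<^esub> w)"
        using complex_module_commute[OF rV(2) \<open>v \<in> carrier V\<close> m(1)] m(4)[OF \<open>v \<in> carrier V\<close>]
        by (simp add: neg)
      also have "\<dots> = v \<oplus>\<^bsub>V\<^esub> (-1) \<odot>\<^bsub>V\<^esub> w \<oplus>\<^bsub>V\<^esub> w"
        by (rule m(3)[symmetric]) (use \<open>v \<in> carrier V\<close> \<open>w \<in> carrier V\<close> m(5) in auto)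
      also have "\<dots> = w" using \<open>w \<in> carrier V\<close> m(4) by (simp add: 0)
      finally show ?thesis .
    qed
    then show ?thesis using neg by blast
  qed
  have eval_diff_zero: "tensor_eval V (f - g) = \<zero>\<^bsub>V\<^esub>"
    if "tensor_eval V f = tensor_eval V g" "Poly_Mapping.keys f \<subseteq> ?B" "Poly_Mapping.keys g \<subseteq> ?B" for f g
    using eval_diff[OF that(2,3)] cancel tensor_eval_closed[OF rV(2)] that by simp
  have eval_diff_add_zero: "tensor_eval V (f - g - g') = \<zero>\<^bsub>V\<^esub>"
    if "tensor_eval V f = tensor_eval V g \<oplus>\<^bsub>V\<^esub> tensor_eval V g'"
      and k: "Poly_Mapping.keys f \<subseteq> ?B" "Poly_Mapping.keys g \<subseteq> ?B" "Poly_Mapping.keys g' \<subseteq> ?B" for f g g'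
  proof -
    have "Poly_Mapping.keys (g + g') \<subseteq> ?B" using keys_add[of g g'] k by blast
    then show ?thesis
      unfolding diff_diff_eq using eval_diff_zero k that(1) tensor_eval_add[OF rV(2) k(2,3)] by simp
  qed
  have eval_R: "tensor_eval V r = \<zero>\<^bsub>V\<^esub>" if "r \<in> ?R" for r
    using that
  proof (cases rule: bilinear_relators_triv_cases)
    case (add_left v v' w)
    then show ?thesis unfolding add_left(3)
      by (intro eval_diff_add_zero) (simp_all add: tensor_eval_single[OF rV(2)] m)
  next
    case (add_right v w w')
    then show ?thesis unfolding add_right(2)
      by (intro eval_diff_add_zero) (simp_all add: tensor_eval_single[OF rV(2)] m)
  next
    case (smult_left c v w)
    then show ?thesis unfolding smult_left(2)
      by (intro eval_diff_zero) (simp_all add: tensor_eval_single[OF rV(2)] m(5) m(8)[symmetric] mult.commute)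
  next
    case (smult_right c v w)
    then show ?thesis unfolding smult_right(2)
      by (intro eval_diff_zero) (simp_all add: tensor_eval_single[OF rV(2)])
  qed
  have eval_N: "tensor_eval V f = \<zero>\<^bsub>V\<^esub>" if "f \<in> N" for f
  proof -
    let ?S = "{f. Poly_Mapping.keys f \<subseteq> ?B \<and> tensor_eval V f = \<zero>\<^bsub>V\<^esub>}"
    have "N \<subseteq> ?S"
      unfolding N_def
    proof (rule free_span_minimal)
      show "?R \<subseteq> ?S" using R eval_R by blast
      show "0 \<in> ?S" using eval_diff_zero[of 0 0] by simp
      show "f + g \<in> ?S" if "f \<in> ?S" "g \<in> ?S" for f g
        using that tensor_eval_add[OF rV(2), of f g] keys_add[of f g] m(1,4) by auto
      show "Poly_Mapping.map ((*) c) f \<in> ?S" if "f \<in> ?S" for c f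
      proof -
        have "c \<odot>\<^bsub>V\<^esub> \<zero>\<^bsub>V\<^esub> = \<zero>\<^bsub>V\<^esub>"
          using m(8)[OF m(1), of c 0] m(10)[OF m(1)] by simp
        then show ?thesis
          using that tensor_eval_smult[OF rV(2), of f c] keys_map_times[of c f] by auto
      qed
    qed auto
    then show ?thesis using that by blast
  qed
  have inj: "inj_on ?\<phi> (carrier V)"
  proof (rule inj_onI)
    fix v w assume vw: "v \<in> carrier V" "w \<in> carrier V" "?\<phi> v = ?\<phi> w"
    then have "?e v - ?e w \<in> N" using Q(5) by blast
    then have "tensor_eval V (?e v) \<oplus>\<^bsub>V\<^esub> (-1) \<odot>\<^bsub>V\<^esub> tensor_eval V (?e w) = \<zero>\<^bsub>V\<^esub>"
      using eval_N eval_diff[OF e e] vw by metis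
    then show "v = w" using vw cancel by (simp add: tensor_eval_single[OF rV(2)] m)
  qed
  have rel_add: "?e (v \<oplus>\<^bsub>V\<^esub> v') - ?e v - ?e v' \<in> N"
    if "v \<in> carrier V" "v' \<in> carrier V" for v v'
    using N(1) that unfolding bilinear_relators_triv by blast
  have rel_smult: "Poly_Mapping.single (c \<odot>\<^bsub>V\<^esub> v, w) 1 - Poly_Mapping.single (v, w) c \<in> N"
    if "v \<in> carrier V" for c v w
    using N(1) that unfolding bilinear_relators_triv by blast
  have rel_scalar: "Poly_Mapping.single (v, c * w) 1 - Poly_Mapping.single (v, w) c \<in> N"
    if "v \<in> carrier V" for c v w
    using N(1) that unfolding bilinear_relators_triv by blast
  have e_zero: "?e \<zero>\<^bsub>V\<^esub> \<in> N" using rel_smult[OF m(1), of 0 1] m(1,10) by simp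
  have surj: "\<exists>v\<in>carrier V. f - ?e v \<in> N" if "Poly_Mapping.keys f \<subseteq> ?B" for f
    using that
  proof (induction f rule: finitely_supported_induct)
    case zero
    show ?case using N(5)[OF N(3) e_zero] m(1) by blast
  next
    case (single x c)
    obtain v w where x: "x = (v, w)" and v: "v \<in> carrier V" using single by auto
    let ?u = "c \<odot>\<^bsub>V\<^esub> v"
    have u: "?u \<in> carrier V" using v m by simp
    \<comment> \<open>\<open>c (v \<otimes> w) = c v \<otimes> w = w (c v \<otimes> 1) = w c v \<otimes> 1\<close>\<close>
    have "Poly_Mapping.single (v, w) c - ?e (w \<odot>\<^bsub>V\<^esub> ?u)
      = (Poly_Mapping.single (?u, w * 1) 1 - Poly_Mapping.single (?u, 1) w)
        - (Poly_Mapping.single (?u, w) 1 - Poly_Mapping.single (v, w) c)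
        - (?e (w \<odot>\<^bsub>V\<^esub> ?u) - Poly_Mapping.single (?u, 1) w)" by simp
    also have "\<dots> \<in> N" by (intro N(5) rel_smult rel_scalar u v)
    finally show ?case using u m x by blast
  next
    case (add f g)
    then obtain v v' where v: "v \<in> carrier V" "v' \<in> carrier V" "f - ?e v \<in> N" "g - ?e v' \<in> N" by blast
    have "f + g - ?e (v \<oplus>\<^bsub>V\<^esub> v')
      = (f - ?e v) + (g - ?e v') - (?e (v \<oplus>\<^bsub>V\<^esub> v') - ?e v - ?e v')" by simp
    also have "\<dots> \<in> N" by (intro N(4,5) v rel_add)
    finally show ?case using v m(2) by blast
  qed
  have bij: "bij_betw ?\<phi> (carrier V) (carrier ?T)"
  proof (rule bij_betw_imageI[OF inj])
    show "?\<phi> ` carrier V = carrier ?T"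
    proof
      show "?\<phi> ` carrier V \<subseteq> carrier ?T" unfolding T Q(1) using e by blast
      show "carrier ?T \<subseteq> ?\<phi> ` carrier V" unfolding T Q(1) using surj Q(5) by blast
    qed
  qed
  let ?f = "\<lambda>g. free_map (map_prod (act V g) (id :: complex \<Rightarrow> complex))"
  have f_N: "?f g r \<in> N" if g: "g \<in> carrier G" and r: "r \<in> N" for g r
  proof -
    let ?S = "{r. Poly_Mapping.keys r \<subseteq> ?B \<and> ?f g r \<in> N}"
    have "N \<subseteq> ?S"
      unfolding N_def
    proof (rule free_span_minimal, fold N_def)
      have "?f g r \<in> ?R" if "r \<in> ?R" for r
        using that
      proof (cases rule: bilinear_relators_triv_cases)
        case (add_left v v' w)
        then show ?thesis using rV(4)[OF g]
          unfolding add_left(3) bilinear_relators_triv free_map_diff free_map_single map_prod_simp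
            id_apply rV(7)[OF g add_left(1,2)] by blast
      next
        case (add_right v w w')
        then show ?thesis using rV(4)[OF g]
          unfolding add_right(2) bilinear_relators_triv free_map_diff free_map_single map_prod_simp
            id_apply by blast
      next
        case (smult_left c v w)
        then show ?thesis using rV(4)[OF g]
          unfolding smult_left(2) bilinear_relators_triv free_map_diff free_map_single map_prod_simp
            id_apply rV(8)[OF g smult_left(1)] by blast
      next
        case (smult_right c v w)
        then show ?thesis using rV(4)[OF g]
          unfolding smult_right(2) bilinear_relators_triv free_map_diff free_map_single map_prod_simp
            id_apply by blast
      qed
      then show "?R \<subseteq> ?S" using R N(1) by blast
      show "0 \<in> ?S" using N(3) by (simp add: free_map_zero)
      show "r + s \<in> ?S" if "r \<in> ?S" "s \<in> ?S" for r s
        using that N(4) keys_add[of r s] by (auto simp: free_map_add)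
      show "Poly_Mapping.map ((*) c) r \<in> ?S" if "r \<in> ?S" for c r
        using that N(6) keys_map_times[of c r] by (auto simp: free_map_smult)
    qed auto
    then show ?thesis using r by blast
  qed
  have f_inv: "?f g (?f (inv g) r) = r" if "g \<in> carrier G" "Poly_Mapping.keys r \<subseteq> ?B" for g r
    by (rule free_map_left_inverse[OF that(2)])
      (use that(1) rV(5) in \<open>auto simp: rV(6)[symmetric]\<close>)
  have f_coset: "?f g ` coset N r = coset N (?f g r)"
    if g: "g \<in> carrier G" and r: "Poly_Mapping.keys r \<subseteq> ?B" for g r
  proof
    show "?f g ` coset N r \<subseteq> coset N (?f g r)"
      using f_N[OF g] by (auto simp: in_coset simp flip: free_map_diff)
    show "coset N (?f g r) \<subseteq> ?f g ` coset N r"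
    proof
      fix s assume "s \<in> coset N (?f g r)"
      then have s: "s - ?f g r \<in> N" by (simp add: in_coset)
      then have k: "Poly_Mapping.keys (s - ?f g r) \<subseteq> ?B" using N(2) by blast
      let ?t = "?f (inv g) (s - ?f g r)"
      have "?t + r \<in> coset N r" using f_N[OF inv_closed[OF g] s] by (simp add: in_coset)
      moreover have "?f g (?t + r) = s" using f_inv[OF g k] by (simp add: free_map_add)
      ultimately show "s \<in> ?f g ` coset N r" by (metis image_eqI)
    qed
  qed
  have pull: "representation (G \<times>\<times> H) (pull_rep fst V)"
    by (rule pull_representation[OF DirProd_group[OF rV(1) H] _ V]) (auto intro!: homI simp: DirProd_def)
  then show ?thesis
  proof (rule rep_iso_transport[where \<phi>="?\<phi>"])
    show "bij_betw ?\<phi> (carrier (pull_rep fst V)) (carrier ?T)" using bij by simp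
    show "\<zero>\<^bsub>?T\<^esub> = ?\<phi> \<zero>\<^bsub>pull_rep fst V\<^esub>"
      using N(5)[OF N(3) e_zero] unfolding T Q(2) pull_rep_sel Q(5) .
    show "?\<phi> (v \<oplus>\<^bsub>pull_rep fst V\<^esub> w) = ?\<phi> v \<oplus>\<^bsub>?T\<^esub> ?\<phi> w"
      if "v \<in> carrier (pull_rep fst V)" "w \<in> carrier (pull_rep fst V)" for v w
      using that rel_add unfolding T Q(3) pull_rep_sel Q(5) by (simp add: diff_diff_eq)
    show "?\<phi> (c \<odot>\<^bsub>pull_rep fst V\<^esub> v) = c \<odot>\<^bsub>?T\<^esub> ?\<phi> v"
      if "v \<in> carrier (pull_rep fst V)" for c v
      using that rel_smult unfolding T Q(4) pull_rep_sel Q(5) by (simp add: map_times_single)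
    show "?\<phi> (act (pull_rep fst V) x v) = act ?T x (?\<phi> v)"
      if gh: "x \<in> carrier (G \<times>\<times> H)" and "v \<in> carrier (pull_rep fst V)" for x v
    proof -
      obtain g h where x: "x = (g, h)" and g: "g \<in> carrier G" using gh by (auto simp: DirProd_def)
      have v: "v \<in> carrier V" using that by simp
      have "?\<phi> v \<in> carrier (quotient_module (free_module ?B) N)" unfolding Q(1) using e[OF v] by blast
      then have "act ?T x (?\<phi> v) = ?f g ` ?\<phi> v" by (simp add: T x)
      also have "\<dots> = coset N (?f g (?e v))" by (rule f_coset[OF g e[OF v]])
      finally show ?thesis by (simp add: free_map_single x)
    qed
    show "act ?T x \<in> extensional (carrier ?T)" if "x \<in> carrier (G \<times>\<times> H)" for x
      unfolding T by (cases x) simp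
  qed
qed

lemma permutesI_inj_on:
  assumes "finite S" "\<And>x. x \<in> S \<Longrightarrow> p x \<in> S" "inj_on p S" "\<And>x. x \<notin> S \<Longrightarrow> p x = x"
  shows "p permutes S"
proof (rule bij_imp_permutes)
  have "p ` S = S" by (rule endo_inj_surj) (use assms in auto)
  then show "bij_betw p S S" using assms(3) by (simp add: bij_betw_def)
qed (rule assms(4))

lemma permutes_disjoint_commute:
  assumes "p permutes A" "q permutes B" "A \<inter> B = {}"
  shows "p \<circ> q = q \<circ> p"
proof
  fix x
  consider "x \<in> A" | "x \<in> B" | "x \<notin> A" "x \<notin> B" by blast
  then show "(p \<circ> q) x = (q \<circ> p) x"
  proof cases
    case 1
    then have "x \<notin> B" "p x \<notin> B" using assms permutes_in_image[OF assms(1)] by blast+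
    then show ?thesis by (simp add: permutes_not_in[OF assms(2)])
  next
    case 2
    then have "x \<notin> A" "q x \<notin> A" using assms permutes_in_image[OF assms(2)] by blast+
    then show ?thesis by (simp add: permutes_not_in[OF assms(1)])
  qed (simp add: permutes_not_in[OF assms(1)] permutes_not_in[OF assms(2)])
qed

lemma perm_group_group: "group (perm_group A)"
proof (rule groupI)
  show "\<exists>q\<in>carrier (perm_group A). q \<otimes>\<^bsub>perm_group A\<^esub> p = \<one>\<^bsub>perm_group A\<^esub>"
    if "p \<in> carrier (perm_group A)" for p
    using that permutes_inv permutes_inv_o(2) by (fastforce simp: perm_group_def)
qed (auto simp: perm_group_def permutes_compose permutes_id comp_assoc)

section \<open>Wreath products acting on consecutive blocks\<close>

lemma block_point_mem:
  assumes "j \<in> {1..n}" "i \<in> {1..m}" shows "(j - 1) * m + i \<in> {1..m * n :: nat}"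
proof -
  have "(j - 1) * m + i \<le> (j - 1) * m + m" using assms by simp
  also have "\<dots> = j * m" using assms by (cases j) auto
  also have "\<dots> \<le> n * m" using assms by simp
  finally show ?thesis using assms by (simp add: mult.commute)
qed

lemma block_point_cases:
  assumes "x \<in> {1..m * n :: nat}"
  obtains j i where "j \<in> {1..n}" "i \<in> {1..m}" "x = (j - 1) * m + i"
proof -
  have "0 < m" using assms by (cases m) auto
  have "x - 1 < n * m" using assms by (simp add: mult.commute) linarith
  then have "(x - 1) div m < n" using \<open>0 < m\<close> by (simp add: less_mult_imp_div_less)
  moreover have "(x - 1) mod m < m" using \<open>0 < m\<close> by simp
  moreover have "x = (x - 1) div m * m + ((x - 1) mod m + 1)" using assms by simp
  ultimately show thesis
    by (intro that[of "(x - 1) div m + 1" "(x - 1) mod m + 1"]) auto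
qed

lemma block_point_inject:
  assumes "i \<in> {1..m}" "i' \<in> {1..m}" "1 \<le> j" "1 \<le> j'" "(j - 1) * m + i = (j' - 1) * m + (i' :: nat)"
  shows "j = j' \<and> i = i'"
proof -
  have div: "((k - 1) * m + l - 1) div m = k - 1" if "l \<in> {1..m}" for k l :: nat
  proof -
    have "(k - 1) * m + l - 1 = (l - 1) + (k - 1) * m" "l - 1 < m" using that by auto
    then show ?thesis by simp
  qed
  have "j - 1 = j' - 1" using div[OF assms(1), of j] div[OF assms(2), of j'] assms(5) by simp
  then show ?thesis using assms by simp
qed

text \<open>Every datum \<open>\<sigma>\<close>, \<open>\<tau>\<close> is realized, because the points of the blocks correspond uniquely to pairs
  of a block index and a position in the block.\<close>

lemma block_permutation_exists:
  fixes m n :: nat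
  assumes \<sigma>: "\<sigma> permutes {1..n}" and \<tau>: "\<And>j. j \<in> {1..n} \<Longrightarrow> \<tau> j permutes {1..m}"
  obtains p where "p permutes {1..m * n}"
    and "\<And>j i. \<lbrakk>j \<in> {1..n}; i \<in> {1..m}\<rbrakk> \<Longrightarrow> p ((j - 1) * m + i) = (\<sigma> j - 1) * m + \<tau> j i"
proof -
  define p where "p x = (if x \<in> {1..m * n}
    then (THE y. \<exists>j\<in>{1..n}. \<exists>i\<in>{1..m}. x = (j - 1) * m + i \<and> y = (\<sigma> j - 1) * m + \<tau> j i) else x)" for x
  have p: "p ((j - 1) * m + i) = (\<sigma> j - 1) * m + \<tau> j i" if ji: "j \<in> {1..n}" "i \<in> {1..m}" for j i
  proof -
    have "(THE y. \<exists>j'\<in>{1..n}. \<exists>i'\<in>{1..m}. (j - 1) * m + i = (j' - 1) * m + i' \<and> y = (\<sigma> j' - 1) * m + \<tau> j' i')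
        = (\<sigma> j - 1) * m + \<tau> j i"
    proof (rule the_equality)
      show "\<exists>j'\<in>{1..n}. \<exists>i'\<in>{1..m}. (j - 1) * m + i = (j' - 1) * m + i' \<and>
          (\<sigma> j - 1) * m + \<tau> j i = (\<sigma> j' - 1) * m + \<tau> j' i'" using ji by blast
      fix y assume "\<exists>j'\<in>{1..n}. \<exists>i'\<in>{1..m}. (j - 1) * m + i = (j' - 1) * m + i' \<and> y = (\<sigma> j' - 1) * m + \<tau> j' i'"
      then obtain j' i' where "j' \<in> {1..n}" "i' \<in> {1..m}" "(j - 1) * m + i = (j' - 1) * m + i'"
        and y: "y = (\<sigma> j' - 1) * m + \<tau> j' i'" by blast
      then have "j = j' \<and> i = i'" using ji
        by - (rule block_point_inject[of i m i' j j'], auto)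
      then show "y = (\<sigma> j - 1) * m + \<tau> j i" using y by simp
    qed
    then show ?thesis unfolding p_def using block_point_mem[OF ji] by simp
  qed
  have mem: "\<sigma> j \<in> {1..n}" "\<tau> j i \<in> {1..m}" if "j \<in> {1..n}" "i \<in> {1..m}" for j i
    using that permutes_in_image[OF \<sigma>] permutes_in_image[OF \<tau>[OF that(1)]] by blast+
  have "p permutes {1..m * n}"
  proof (rule permutesI_inj_on)
    show "p x \<in> {1..m * n}" if x: "x \<in> {1..m * n}" for x
    proof -
      obtain j i where ji: "j \<in> {1..n}" "i \<in> {1..m}" "x = (j - 1) * m + i" by (rule block_point_cases[OF x])
      show ?thesis unfolding ji(3) p[OF ji(1,2)] by (rule block_point_mem[OF mem[OF ji(1,2)]])
    qed
    show "inj_on p {1..m * n}"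
    proof (rule inj_onI)
      fix x y assume x: "x \<in> {1..m * n}" and y: "y \<in> {1..m * n}" and eq: "p x = p y"
      obtain j i where ji: "j \<in> {1..n}" "i \<in> {1..m}" "x = (j - 1) * m + i" by (rule block_point_cases[OF x])
      obtain k l where kl: "k \<in> {1..n}" "l \<in> {1..m}" "y = (k - 1) * m + l" by (rule block_point_cases[OF y])
      have "\<sigma> j = \<sigma> k \<and> \<tau> j i = \<tau> k l"
      proof (rule block_point_inject)
        show "(\<sigma> j - 1) * m + \<tau> j i = (\<sigma> k - 1) * m + \<tau> k l"
          using eq unfolding ji(3) kl(3) p[OF ji(1,2)] p[OF kl(1,2)] .
      qed (use mem[OF ji(1,2)] mem[OF kl(1,2)] in auto)
      then have "j = k \<and> i = l"
        using permutes_inj[OF \<sigma>] permutes_inj[OF \<tau>[OF ji(1)]] by (auto dest: injD)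
      then show "x = y" using ji kl by simp
    qed
  qed (auto simp: p_def)
  then show thesis using p that by blast
qed

lemma block_wreathI:
  assumes "p permutes {1..m * n}" "\<sigma> permutes {1..n}" "\<And>j. j \<in> {1..n} \<Longrightarrow> \<tau> j \<in> K"
    and "\<And>j i. \<lbrakk>j \<in> {1..n}; i \<in> {1..m}\<rbrakk> \<Longrightarrow> p ((j - 1) * m + i) = (\<sigma> j - 1) * m + \<tau> j i"
  shows "p \<in> block_wreath K m n"
  using assms unfolding block_wreath_def by blast

lemma block_wreathE:
  assumes "p \<in> block_wreath K m n"
  obtains \<sigma> \<tau> where "p permutes {1..m * n}" "\<sigma> permutes {1..n}" "\<And>j. j \<in> {1..n} \<Longrightarrow> \<tau> j \<in> K"
    and "\<And>j i. \<lbrakk>j \<in> {1..n}; i \<in> {1..m}\<rbrakk> \<Longrightarrow> p ((j - 1) * m + i) = (\<sigma> j - 1) * m + \<tau> j i"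
  using assms unfolding block_wreath_def by blast

lemma sym_subgroupD:
  assumes "subgroup K (sym_group m)"
  shows "id \<in> K" "\<And>\<kappa>. \<kappa> \<in> K \<Longrightarrow> \<kappa> permutes {1..m}" "\<And>\<kappa> \<kappa>'. \<lbrakk>\<kappa> \<in> K; \<kappa>' \<in> K\<rbrakk> \<Longrightarrow> \<kappa> \<circ> \<kappa>' \<in> K"
    "\<And>\<kappa>. \<kappa> \<in> K \<Longrightarrow> inv' \<kappa> \<in> K"
proof -
  show "id \<in> K" using subgroup.one_closed[OF assms] by (simp add: sym_group_one)
  show perm: "\<kappa> permutes {1..m}" if "\<kappa> \<in> K" for \<kappa>
    using subgroup.mem_carrier[OF assms that] by (simp add: sym_group_carrier)
  show "\<kappa> \<circ> \<kappa>' \<in> K" if "\<kappa> \<in> K" "\<kappa>' \<in> K" for \<kappa> \<kappa>'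
    using subgroup.m_closed[OF assms that] by (simp add: sym_group_mult)
  show "inv' \<kappa> \<in> K" if "\<kappa> \<in> K" for \<kappa>
    using subgroup.m_inv_closed[OF assms that] subgroup.mem_carrier[OF assms that] by simp
qed

lemma sym_subgroupI:
  assumes "id \<in> K" "\<And>\<kappa>. \<kappa> \<in> K \<Longrightarrow> \<kappa> permutes {1..m}" "\<And>\<kappa> \<kappa>'. \<lbrakk>\<kappa> \<in> K; \<kappa>' \<in> K\<rbrakk> \<Longrightarrow> \<kappa> \<circ> \<kappa>' \<in> K"
    "\<And>\<kappa>. \<kappa> \<in> K \<Longrightarrow> inv' \<kappa> \<in> K"
  shows "subgroup K (sym_group m)"
proof -
  interpret group "sym_group m" by (rule sym_group_is_group)
  show ?thesis
  proof (rule subgroupI)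
    show "inv\<^bsub>sym_group m\<^esub> \<kappa> \<in> K" if "\<kappa> \<in> K" for \<kappa>
      using that assms(2,4) by (simp add: sym_group_carrier)
  qed (use assms in \<open>auto simp: sym_group_carrier sym_group_mult\<close>)
qed

text \<open>The multiplication of the semidirect product: the data compose to
  \<open>\<sigma> \<sigma>'\<close> and \<open>j \<mapsto> \<tau>\<^bsub>\<sigma>' j\<^esub> \<tau>'\<^sub>j\<close>.\<close>

lemma block_wreath_subgroup:
  assumes K: "subgroup K (sym_group m)"
  shows "subgroup (block_wreath K m n) (sym_group (m * n))"
proof (rule sym_subgroupI)
  note K = sym_subgroupD[OF K]
  show "id \<in> block_wreath K m n"
    by (rule block_wreathI[where \<sigma>=id and \<tau>="\<lambda>_. id"]) (auto simp: permutes_id K(1))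
  show "p permutes {1..m * n}" if "p \<in> block_wreath K m n" for p
    using that by (simp add: block_wreath_def)
  show "p \<circ> p' \<in> block_wreath K m n" if p: "p \<in> block_wreath K m n" and p': "p' \<in> block_wreath K m n" for p p'
  proof -
    obtain \<sigma> \<tau> where a: "p permutes {1..m * n}" "\<sigma> permutes {1..n}" "\<And>j. j \<in> {1..n} \<Longrightarrow> \<tau> j \<in> K"
      "\<And>j i. \<lbrakk>j \<in> {1..n}; i \<in> {1..m}\<rbrakk> \<Longrightarrow> p ((j - 1) * m + i) = (\<sigma> j - 1) * m + \<tau> j i"
      using block_wreathE[OF p] by blast
    obtain \<sigma>' \<tau>' where b: "p' permutes {1..m * n}" "\<sigma>' permutes {1..n}" "\<And>j. j \<in> {1..n} \<Longrightarrow> \<tau>' j \<in> K"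
      "\<And>j i. \<lbrakk>j \<in> {1..n}; i \<in> {1..m}\<rbrakk> \<Longrightarrow> p' ((j - 1) * m + i) = (\<sigma>' j - 1) * m + \<tau>' j i"
      using block_wreathE[OF p'] by blast
    show ?thesis
    proof (rule block_wreathI[where \<sigma>="\<sigma> \<circ> \<sigma>'" and \<tau>="\<lambda>j. \<tau> (\<sigma>' j) \<circ> \<tau>' j"])
      show "p \<circ> p' permutes {1..m * n}" "\<sigma> \<circ> \<sigma>' permutes {1..n}"
        using a b by (auto intro: permutes_compose)
      have \<sigma>': "\<sigma>' j \<in> {1..n}" if "j \<in> {1..n}" for j using permutes_in_image[OF b(2)] that by blast
      then show "\<tau> (\<sigma>' j) \<circ> \<tau>' j \<in> K" if "j \<in> {1..n}" for j using that a b K(3) by blast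
      show "(p \<circ> p') ((j - 1) * m + i) = ((\<sigma> \<circ> \<sigma>') j - 1) * m + (\<tau> (\<sigma>' j) \<circ> \<tau>' j) i"
        if "j \<in> {1..n}" "i \<in> {1..m}" for j i
      proof -
        have "\<tau>' j i \<in> {1..m}" using that permutes_in_image[OF K(2)[OF b(3)]] by blast
        then show ?thesis using that \<sigma>' a(4) b(4) by simp
      qed
    qed
  qed
  show "inv' p \<in> block_wreath K m n" if p: "p \<in> block_wreath K m n" for p
  proof -
    obtain \<sigma> \<tau> where a: "p permutes {1..m * n}" "\<sigma> permutes {1..n}" "\<And>j. j \<in> {1..n} \<Longrightarrow> \<tau> j \<in> K"
      "\<And>j i. \<lbrakk>j \<in> {1..n}; i \<in> {1..m}\<rbrakk> \<Longrightarrow> p ((j - 1) * m + i) = (\<sigma> j - 1) * m + \<tau> j i"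
      using block_wreathE[OF p] by blast
    have inv: "inv' \<sigma> j \<in> {1..n}" if "j \<in> {1..n}" for j
      using permutes_in_image[OF permutes_inv[OF a(2)]] that by blast
    show ?thesis
    proof (rule block_wreathI[where \<sigma>="inv' \<sigma>" and \<tau>="\<lambda>j. inv' (\<tau> (inv' \<sigma> j))"])
      show "inv' p permutes {1..m * n}" "inv' \<sigma> permutes {1..n}" using a permutes_inv by auto
      show "inv' (\<tau> (inv' \<sigma> j)) \<in> K" if "j \<in> {1..n}" for j using inv[OF that] a(3) K(4) by blast
      show "inv' p ((j - 1) * m + i) = (inv' \<sigma> j - 1) * m + inv' (\<tau> (inv' \<sigma> j)) i"
        if "j \<in> {1..n}" "i \<in> {1..m}" for j i
      proof -
        have \<tau>: "\<tau> (inv' \<sigma> j) permutes {1..m}" using inv[OF that(1)] a(3) K(2) by blast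
        then have "inv' (\<tau> (inv' \<sigma> j)) i \<in> {1..m}"
          using permutes_in_image[OF permutes_inv[OF \<tau>]] that by blast
        then have "p ((inv' \<sigma> j - 1) * m + inv' (\<tau> (inv' \<sigma> j)) i) = (j - 1) * m + i"
          using a(4)[OF inv[OF that(1)]] permutes_inverses(1)[OF \<tau>] permutes_inverses(1)[OF a(2)] by simp
        then show ?thesis unfolding permutes_inv_eq[OF a(1)] .
      qed
    qed
  qed
qed

text \<open>To move the last point to position \<open>i\<close> of block \<open>j\<close>, exchange the blocks \<open>j\<close> and \<open>n\<close> after
  moving \<open>m\<close> to \<open>i\<close> in the last block.\<close>

lemma block_wreath_transitive:
  assumes K: "subgroup K (sym_group m)" and trans: "\<And>i. i \<in> {1..m} \<Longrightarrow> \<exists>\<kappa>\<in>K. \<kappa> m = i"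
    and x: "x \<in> {1..m * n}"
  shows "\<exists>p\<in>block_wreath K m n. p (m * n) = x"
proof -
  note K = sym_subgroupD[OF K]
  obtain j i where ji: "j \<in> {1..n}" "i \<in> {1..m}" "x = (j - 1) * m + i" by (rule block_point_cases[OF x])
  obtain \<kappa> where \<kappa>: "\<kappa> \<in> K" "\<kappa> m = i" using trans ji(2) by blast
  let ?\<sigma> = "Transposition.transpose n j" and ?\<tau> = "\<lambda>k. if k = n then \<kappa> else id"
  have \<sigma>: "?\<sigma> permutes {1..n}" using ji by (intro permutes_swap_id) auto
  have \<tau>: "?\<tau> k \<in> K" for k using \<kappa> K(1) by simp
  obtain p where p: "p permutes {1..m * n}"
    "\<And>j i. \<lbrakk>j \<in> {1..n}; i \<in> {1..m}\<rbrakk> \<Longrightarrow> p ((j - 1) * m + i) = (?\<sigma> j - 1) * m + ?\<tau> j i"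
    using block_permutation_exists[OF \<sigma>, of ?\<tau> m] K(2)[OF \<tau>] by blast
  have "p \<in> block_wreath K m n" by (rule block_wreathI[OF p(1) \<sigma> \<tau> p(2)])
  moreover have "p (m * n) = x"
  proof -
    have "m * n = (n - 1) * m + m" using ji by (cases n) auto
    then show ?thesis using p(2)[of n m] ji \<kappa> by simp
  qed
  ultimately show ?thesis by blast
qed

text \<open>The embedding of the symmetric group of degree \<open>m\<close> as the permutations of the \<open>n\<close>-th block.\<close>

definition last_block :: "nat \<Rightarrow> nat \<Rightarrow> (nat \<Rightarrow> nat) \<Rightarrow> nat \<Rightarrow> nat" where
  "last_block m n \<kappa> x = (if x \<in> {(n - 1) * m + 1..n * m} then (n - 1) * m + \<kappa> (x - (n - 1) * m) else x)"

lemma permutes_fix_last: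
  assumes "0 < N" shows "p permutes {1..N - 1} \<longleftrightarrow> p permutes {1..N} \<and> p N = (N::nat)"
proof
  assume "p permutes {1..N - 1}"
  then show "p permutes {1..N} \<and> p N = N"
    using assms permutes_subset[of p "{1..N - 1}" "{1..N}"] permutes_not_in[of p "{1..N - 1}" N] by auto
next
  assume p: "p permutes {1..N} \<and> p N = N"
  have "x = N" if "x \<in> {1..N} - {1..N - 1}" for x using that by auto
  then show "p permutes {1..N - 1}" using p permutes_superset[of p "{1..N}" "{1..N - 1}"] by blast
qed

text \<open>If \<open>(\<sigma> n - 1) m + \<tau>\<^sub>n m = (n - 1) m + m\<close>, then \<open>\<sigma> n = n\<close> and \<open>\<tau>\<^sub>n m = m\<close> by the uniqueness of
  block coordinates. The remaining data describe an element of the wreath product on \<open>n - 1\<close>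
  blocks, and the two factors act on disjoint sets of points.\<close>

lemma block_wreath_point_stabilizer:
  assumes K: "subgroup K (sym_group m)" and m: "0 < m" and n: "0 < n"
  shows "{p \<in> block_wreath K m n. p permutes {1..m * n - 1}}
    = {p \<circ> last_block m n \<kappa> | p \<kappa>. p \<in> block_wreath K m (n - 1) \<and> \<kappa> \<in> K \<and> \<kappa> m = m}"
    (is "?L = ?R")
proof
  note K = sym_subgroupD[OF K]
  have mn: "m * n = (n - 1) * m + m" "n * m = (n - 1) * m + m" "m * (n - 1) = (n - 1) * m"
    using n by (cases n; simp)+
  have lb_old: "last_block m n \<kappa> ((j - 1) * m + i) = (j - 1) * m + i"
    if "j \<in> {1..n - 1}" "i \<in> {1..m}" for \<kappa> j i
  proof -
    have "(j - 1) * m + i \<le> (n - 1) * m" using block_point_mem[OF that] unfolding mn(3) by simp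
    then show ?thesis by (simp add: last_block_def)
  qed
  have lb_new: "last_block m n \<kappa> ((n - 1) * m + i) = (n - 1) * m + \<kappa> i"
    if "i \<in> {1..m}" for \<kappa> i
    using that mn by (auto simp: last_block_def)
  have cases_n: "j \<in> {1..n - 1} \<or> j = n" if "j \<in> {1..n}" for j using that n by auto
  show "?R \<subseteq> ?L"
  proof
    fix r assume "r \<in> ?R"
    then obtain p \<kappa> where r: "r = p \<circ> last_block m n \<kappa>" and p: "p \<in> block_wreath K m (n - 1)"
      and \<kappa>: "\<kappa> \<in> K" "\<kappa> m = m" by blast
    obtain \<sigma> \<tau> where a: "p permutes {1..m * (n - 1)}" "\<sigma> permutes {1..n - 1}"
      "\<And>j. j \<in> {1..n - 1} \<Longrightarrow> \<tau> j \<in> K"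
      "\<And>j i. \<lbrakk>j \<in> {1..n - 1}; i \<in> {1..m}\<rbrakk> \<Longrightarrow> p ((j - 1) * m + i) = (\<sigma> j - 1) * m + \<tau> j i"
      using block_wreathE[OF p] by blast
    let ?\<tau> = "\<lambda>j. if j = n then \<kappa> else \<tau> j"
    have \<sigma>: "\<sigma> permutes {1..n}" by (rule permutes_subset[OF a(2)]) auto
    have \<sigma>n: "\<sigma> n = n" by (rule permutes_not_in[OF a(2)]) (use n in auto)
    have \<tau>: "?\<tau> j \<in> K" if "j \<in> {1..n}" for j using cases_n[OF that] a(3) \<kappa> by auto
    have r_eq: "r ((j - 1) * m + i) = (\<sigma> j - 1) * m + ?\<tau> j i" if "j \<in> {1..n}" and i: "i \<in> {1..m}" for j i
      using cases_n[OF that(1)]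
    proof
      assume "j \<in> {1..n - 1}"
      moreover from this have "j \<noteq> n" using n by auto
      ultimately show ?thesis using a(4) i lb_old r by simp
    next
      assume "j = n"
      moreover have "\<kappa> i \<in> {1..m}" using permutes_in_image[OF K(2)[OF \<kappa>(1)]] i by blast
      then have "p ((n - 1) * m + \<kappa> i) = (n - 1) * m + \<kappa> i"
        by (intro permutes_not_in[OF a(1)]) (auto simp: mn)
      ultimately show ?thesis using lb_new[OF i] r \<sigma>n by simp
    qed
    obtain q where q: "q permutes {1..m * n}"
      "\<And>j i. \<lbrakk>j \<in> {1..n}; i \<in> {1..m}\<rbrakk> \<Longrightarrow> q ((j - 1) * m + i) = (\<sigma> j - 1) * m + ?\<tau> j i"
      using block_permutation_exists[OF \<sigma>, of ?\<tau> m] K(2)[OF \<tau>] by blast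
    have "r = q"
    proof
      fix x show "r x = q x"
      proof (cases "x \<in> {1..m * n}")
        case True
        then show ?thesis using q(2) r_eq by (elim block_point_cases) simp
      next
        case False
        then have "last_block m n \<kappa> x = x" "x \<notin> {1..m * (n - 1)}"
          unfolding last_block_def mn by auto
        then show ?thesis using r permutes_not_in[OF a(1)] permutes_not_in[OF q(1) False] by simp
      qed
    qed
    then have r_perm: "r permutes {1..m * n}" using q(1) by simp
    have "r \<in> block_wreath K m n" by (rule block_wreathI[OF r_perm \<sigma> \<tau> r_eq])
    moreover have "r (m * n) = m * n" using r_eq[of n m] m n \<sigma>n \<kappa>(2) mn(1) by simp
    ultimately show "r \<in> ?L" using r_perm permutes_fix_last[of "m * n" r] m n by simp
  qed
  show "?L \<subseteq> ?R"
  proof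
    fix r assume "r \<in> ?L"
    then have r: "r \<in> block_wreath K m n" and fixm: "r (m * n) = m * n"
      using permutes_fix_last[of "m * n" r] m n by auto
    obtain \<sigma> \<tau> where a: "r permutes {1..m * n}" "\<sigma> permutes {1..n}"
      "\<And>j. j \<in> {1..n} \<Longrightarrow> \<tau> j \<in> K"
      "\<And>j i. \<lbrakk>j \<in> {1..n}; i \<in> {1..m}\<rbrakk> \<Longrightarrow> r ((j - 1) * m + i) = (\<sigma> j - 1) * m + \<tau> j i"
      using block_wreathE[OF r] by blast
    have nn: "n \<in> {1..n}" and mm: "m \<in> {1..m}" using m n by auto
    have \<tau>_mem: "\<tau> j i \<in> {1..m}" if "j \<in> {1..n}" "i \<in> {1..m}" for j i
      using permutes_in_image[OF K(2)[OF a(3)[OF that(1)]]] that by blast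
    have \<sigma>_mem: "\<sigma> j \<in> {1..n}" if "j \<in> {1..n}" for j
      using permutes_in_image[OF a(2)] that by blast
    have fixed: "\<sigma> n = n \<and> \<tau> n m = m"
    proof (rule block_point_inject[OF \<tau>_mem[OF nn mm] mm])
      show "(\<sigma> n - 1) * m + \<tau> n m = (n - 1) * m + m" using a(4)[OF nn mm] fixm mn by simp
    qed (use \<sigma>_mem[OF nn] n in auto)
    have \<sigma>: "\<sigma> permutes {1..n - 1}" using permutes_fix_last[OF n] a(2) fixed by blast
    have sub: "j \<in> {1..n}" if "j \<in> {1..n - 1}" for j using that by auto
    obtain p where p: "p permutes {1..m * (n - 1)}"
      "\<And>j i. \<lbrakk>j \<in> {1..n - 1}; i \<in> {1..m}\<rbrakk> \<Longrightarrow> p ((j - 1) * m + i) = (\<sigma> j - 1) * m + \<tau> j i"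
      using block_permutation_exists[OF \<sigma>, of \<tau> m] K(2)[OF a(3)[OF sub]] by blast
    have pW: "p \<in> block_wreath K m (n - 1)" by (rule block_wreathI[OF p(1) \<sigma> a(3)[OF sub] p(2)])
    have "r = p \<circ> last_block m n (\<tau> n)"
    proof
      fix x show "r x = (p \<circ> last_block m n (\<tau> n)) x"
      proof (cases "x \<in> {1..m * n}")
        case True
        then obtain j i where ji: "j \<in> {1..n}" "i \<in> {1..m}" "x = (j - 1) * m + i" by (rule block_point_cases)
        from cases_n[OF ji(1)] show ?thesis
        proof
          assume "j \<in> {1..n - 1}"
          then show ?thesis using a(4)[OF ji(1,2)] p(2) ji lb_old by simp
        next
          assume j: "j = n"
          have "p ((n - 1) * m + \<tau> n i) = (n - 1) * m + \<tau> n i"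
            by (rule permutes_not_in[OF p(1)]) (use \<tau>_mem[OF nn ji(2)] in \<open>auto simp: mn\<close>)
          then show ?thesis using a(4)[OF ji(1,2)] ji lb_new fixed j by simp
        qed
      next
        case False
        then have "last_block m n (\<tau> n) x = x" "x \<notin> {1..m * (n - 1)}"
          unfolding last_block_def mn by auto
        then show ?thesis using permutes_not_in[OF p(1)] permutes_not_in[OF a(1) False] by simp
      qed
    qed
    then show "r \<in> ?R" using pW a(3)[OF nn] fixed by blast
  qed
qed

lemma last_block_id: "last_block m n id = id"
  by (auto simp: last_block_def fun_eq_iff)

lemma last_block_image:
  assumes m: "0 < m" and n: "0 < n"
  shows "last_block m n ` {\<kappa>. \<kappa> permutes {1..m} \<and> \<kappa> m = m} = {q. q permutes {(n - 1) * m + 1..n * m - 1}}"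
    (is "_ ` ?A = ?B")
proof
  define N where "N = (n - 1) * m"
  have nm: "n * m = N + m" using n by (cases n) (auto simp: N_def)
  have lb: "last_block m n \<kappa> x = (if x \<in> {N + 1..N + m} then N + \<kappa> (x - N) else x)" for \<kappa> x
    unfolding last_block_def nm N_def[symmetric] ..
  show "last_block m n ` ?A \<subseteq> ?B"
  proof (intro image_subsetI CollectI)
    fix \<kappa> assume "\<kappa> \<in> ?A"
    then have \<kappa>: "\<kappa> permutes {1..m - 1}" using permutes_fix_last[OF m] by blast
    let ?q = "last_block m n \<kappa>"
    have q_in: "?q x = N + \<kappa> (x - N)" "x - N \<in> {1..m - 1}" if "x \<in> {N + 1..N + m - 1}" for x
      using that by (auto simp: lb)
    have \<kappa>_in: "\<kappa> (x - N) \<in> {1..m - 1}" if "x \<in> {N + 1..N + m - 1}" for x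
      using permutes_in_image[OF \<kappa>] q_in(2)[OF that] by blast
    have "?q permutes {N + 1..N + m - 1}"
    proof (rule permutesI_inj_on)
      show "?q x \<in> {N + 1..N + m - 1}" if "x \<in> {N + 1..N + m - 1}" for x
        using \<kappa>_in[OF that] m unfolding q_in(1)[OF that] by auto
      show "inj_on ?q {N + 1..N + m - 1}"
      proof (rule inj_onI)
        fix x y assume xy: "x \<in> {N + 1..N + m - 1}" "y \<in> {N + 1..N + m - 1}" "?q x = ?q y"
        then have "\<kappa> (x - N) = \<kappa> (y - N)" using q_in(1) by simp
        then have "x - N = y - N" using permutes_inj[OF \<kappa>] by (simp add: inj_eq)
        then show "x = y" using xy by auto
      qed
      show "?q x = x" if "x \<notin> {N + 1..N + m - 1}" for x
      proof (cases "x = N + m")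
        case True
        then show ?thesis using permutes_not_in[OF \<kappa>, of m] m by (simp add: lb)
      next
        case False
        then show ?thesis using that by (auto simp: lb)
      qed
    qed simp
    then show "?q permutes {(n - 1) * m + 1..n * m - 1}" unfolding nm N_def[symmetric] .
  qed
  show "?B \<subseteq> last_block m n ` ?A"
  proof
    fix q assume "q \<in> ?B"
    then have q: "q permutes {N + 1..N + m - 1}" unfolding nm N_def[symmetric] by (rule CollectD)
    define \<kappa> where "\<kappa> i = (if i \<in> {1..m - 1} then q (N + i) - N else i)" for i
    have q_in: "q (N + i) \<in> {N + 1..N + m - 1}" if "i \<in> {1..m - 1}" for i
      using permutes_in_image[OF q, of "N + i"] that by auto
    have "\<kappa> permutes {1..m - 1}"
    proof (rule permutesI_inj_on)
      show "\<kappa> i \<in> {1..m - 1}" if "i \<in> {1..m - 1}" for i using q_in[OF that] that by (auto simp: \<kappa>_def)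
      show "inj_on \<kappa> {1..m - 1}"
      proof (rule inj_onI)
        fix i j assume ij: "i \<in> {1..m - 1}" "j \<in> {1..m - 1}" "\<kappa> i = \<kappa> j"
        then have "q (N + i) = q (N + j)" using q_in[OF ij(1)] q_in[OF ij(2)] by (auto simp: \<kappa>_def)
        then show "i = j" using permutes_inj[OF q] by (simp add: inj_eq)
      qed
    qed (auto simp: \<kappa>_def)
    then have "\<kappa> \<in> ?A" using permutes_fix_last[OF m] by blast
    moreover have "q = last_block m n \<kappa>"
    proof
      fix x
      show "q x = last_block m n \<kappa> x"
      proof (cases "x \<in> {N + 1..N + m - 1}")
        case True
        then have "x - N \<in> {1..m - 1}" "x = N + (x - N)" by auto
        then have "q x = N + \<kappa> (x - N)" using q_in[of "x - N"] by (auto simp: \<kappa>_def)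
        then show ?thesis using True by (auto simp: lb)
      next
        case False
        then have "x = N + m \<or> x \<notin> {N + 1..N + m}" by auto
        then show ?thesis using permutes_not_in[OF q False] by (auto simp: lb \<kappa>_def)
      qed
    qed
    ultimately show "q \<in> last_block m n ` ?A" by blast
  qed
qed

section \<open>The cyclic group generated by a long cycle\<close>

lemma cycle_power_transitive:
  assumes cs: "cycle cs" and x: "x \<in> set cs" and y: "y \<in> set cs"
  shows "\<exists>k. (cycle_of_list cs ^^ k) x = y"
proof -
  obtain a b where a: "a < length cs" "x = cs ! a" and b: "b < length cs" "y = cs ! b"
    using x y by (auto simp: in_set_conv_nth)
  let ?k = "length cs - a + b"
  have "(cycle_of_list cs ^^ ?k) x = map (cycle_of_list cs ^^ ?k) cs ! a" using a by simp
  also have "\<dots> = rotate ?k cs ! a" by (simp only: cyclic_rotation[OF cs])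
  also have "\<dots> = cs ! ((?k + a) mod length cs)" using a by (simp add: nth_rotate)
  also have "(?k + a) mod length cs = b" using a b by simp
  finally show ?thesis using b by blast
qed

text \<open>Commutation with the cycle holds for the generator and passes to inverses and products; from the
  cycle it passes to its powers.\<close>

lemma cyclic_group_perms:
  assumes cs: "cycle cs" "set cs = {1..m}"
  defines "C \<equiv> generate (sym_group m) {cycle_of_list cs}"
  shows "subgroup C (sym_group m)" and "cycle_of_list cs ^^ k \<in> C"
    and "\<And>\<kappa>. \<kappa> \<in> C \<Longrightarrow> \<kappa> \<circ> cycle_of_list cs ^^ k = cycle_of_list cs ^^ k \<circ> \<kappa>"
proof -
  let ?c = "cycle_of_list cs"
  interpret group "sym_group m" by (rule sym_group_is_group)
  have c: "?c \<in> carrier (sym_group m)" using cycle_permutes[of cs] cs by (simp add: sym_group_carrier)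
  show "subgroup C (sym_group m)" unfolding C_def by (rule generate_is_subgroup) (use c in simp)
  note C = sym_subgroupD[OF this]
  have "?c \<in> C" unfolding C_def by (rule generate.incl) simp
  then show "?c ^^ k \<in> C" by (induction k) (auto simp: C(1,3))
  show "\<kappa> \<circ> ?c ^^ k = ?c ^^ k \<circ> \<kappa>" if "\<kappa> \<in> C" for \<kappa>
  proof -
    have "\<kappa> \<circ> ?c = ?c \<circ> \<kappa>"
      using that unfolding C_def
    proof (induction rule: generate.induct)
      case one
      then show ?case by (simp add: sym_group_one)
    next
      case (incl h)
      then show ?case by simp
    next
      case (inv h)
      then have "inv\<^bsub>sym_group m\<^esub> h = inv' ?c" using c by simp
      then show ?case using c permutes_inv_o[of ?c "{1..m}"] by (simp add: sym_group_carrier)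
    next
      case (eng h1 h2)
      then show ?case unfolding sym_group_mult by (metis comp_assoc)
    qed
    then have comm: "\<kappa> (?c x) = ?c (\<kappa> x)" for x by (metis comp_apply)
    show ?thesis by (induction k) (auto simp: fun_eq_iff comm)
  qed
qed

lemma cyclic_group_transitive:
  assumes "cycle cs" "set cs = {1..m}" "i \<in> {1..m}"
  shows "\<exists>\<kappa>\<in>generate (sym_group m) {cycle_of_list cs}. \<kappa> m = i"
proof -
  obtain k where "(cycle_of_list cs ^^ k) m = i"
    using cycle_power_transitive[OF assms(1), of m i] assms by auto
  then show ?thesis using cyclic_group_perms(2)[OF assms(1,2)] by blast
qed

text \<open>A transitive abelian group of permutations acts freely: an element that fixes \<open>m\<close> also fixes
  every image of \<open>m\<close> under the powers of the cycle, with which it commutes.\<close>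

lemma cyclic_group_free:
  assumes cs: "cycle cs" "set cs = {1..m}" and \<kappa>: "\<kappa> \<in> generate (sym_group m) {cycle_of_list cs}"
    and fixm: "\<kappa> m = m"
  shows "\<kappa> = id"
proof
  fix x
  show "\<kappa> x = id x"
  proof (cases "x \<in> {1..m}")
    case True
    then obtain k where k: "(cycle_of_list cs ^^ k) m = x"
      using cycle_power_transitive[OF cs(1), of m x] cs by auto
    have "\<kappa> ((cycle_of_list cs ^^ k) m) = (cycle_of_list cs ^^ k) (\<kappa> m)"
      using cyclic_group_perms(3)[OF cs \<kappa>, of k] by (metis comp_apply)
    then show ?thesis by (simp add: k fixm)
  next
    case False
    then show ?thesis
      using permutes_not_in sym_subgroupD(2)[OF cyclic_group_perms(1)[OF cs] \<kappa>] by fastforce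
  qed
qed

section \<open>Restricting the permutation representation on the cosets of a wreath product\<close>

text \<open>The form common to both rules. The group \<open>H\<close>, with its maps \<open>\<iota>\<close> to the symmetric group of degree
  \<open>n m - 1\<close> and \<open>\<pi>\<close> to that of degree \<open>(n - 1) m\<close>, is the one from which the right-hand side is induced. The
  assumption \<open>stab\<close> identifies the preimage of the smaller wreath product with the point stabilizer
  in the larger one.\<close>

lemma res_ind_wreath:
  fixes H :: "'h monoid"
  assumes m: "0 < m" and n: "0 < n" and K: "subgroup K (sym_group m)"
    and trans: "\<And>i. i \<in> {1..m} \<Longrightarrow> \<exists>\<kappa>\<in>K. \<kappa> m = i"
    and H: "group H" and \<iota>: "\<iota> \<in> hom H (sym_group (n * m - 1))"
    and \<pi>: "\<pi> \<in> hom H (sym_group ((n - 1) * m))"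
    and surj: "\<pi> ` carrier H = carrier (sym_group ((n - 1) * m))"
    and stab: "\<iota> ` {h \<in> carrier H. \<pi> h \<in> block_wreath K m (n - 1)}
      = {p \<circ> last_block m n \<kappa> | p \<kappa>. p \<in> block_wreath K m (n - 1) \<and> \<kappa> \<in> K \<and> \<kappa> m = m}"
  shows "rep_iso (sym_group (n * m - 1))
    (res_rep (carrier (sym_group (n * m - 1)))
      (ind_rep id ((sym_group (m * n))\<lparr>carrier := block_wreath K m n\<rparr>) (sym_group (m * n)) triv_rep))
    (ind_rep \<iota> H (sym_group (n * m - 1)) (pull_rep \<pi>
      (ind_rep id ((sym_group (m * (n - 1)))\<lparr>carrier := block_wreath K m (n - 1)\<rparr>)
        (sym_group (m * (n - 1))) triv_rep)))"
proof -
  let ?G = "sym_group (m * n)" and ?S = "sym_group (n * m - 1)" and ?L = "sym_group (m * (n - 1))"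
  let ?W = "block_wreath K m n" and ?W' = "block_wreath K m (n - 1)"
  interpret group ?G by (rule sym_group_is_group)
  have comm: "n * m = m * n" "(n - 1) * m = m * (n - 1)" by (simp_all add: mult.commute)
  have mn: "0 < m * n" using m n by simp
  have S: "?S = ?G\<lparr>carrier := carrier ?S\<rparr>" by (simp add: sym_group_def)
  have S_iff: "p \<in> carrier ?S \<longleftrightarrow> p \<in> carrier ?G \<and> p (m * n) = m * n" for p
    using permutes_fix_last[OF mn] by (simp add: sym_group_carrier comm)
  have W: "subgroup ?W ?G" by (rule block_wreath_subgroup[OF K])
  have S_sub: "subgroup (carrier ?S) ?G"
  proof (rule group_incl_imp_subgroup)
    show "carrier ?S \<subseteq> carrier ?G" using S_iff by blast
    show "group (?G\<lparr>carrier := carrier ?S\<rparr>)" using sym_group_is_group S by metis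
  qed
  \<comment> \<open>An element \<open>k\<close> of the wreath product with \<open>k (m n) = g (m n)\<close> splits off from \<open>g\<close> on the left.\<close>
  have decomp: "\<exists>k\<in>?W. \<exists>h\<in>carrier ?S. g = k \<otimes>\<^bsub>?G\<^esub> h" if g: "g \<in> carrier ?G" for g
  proof -
    have gp: "g permutes {1..m * n}" using g by (simp add: sym_group_carrier)
    have "g (m * n) \<in> {1..m * n}" using permutes_in_image[OF gp, of "m * n"] mn by auto
    then obtain k where k: "k \<in> ?W" "k (m * n) = g (m * n)"
      using block_wreath_transitive[OF K trans] by blast
    have kp: "k permutes {1..m * n}" using k(1) by (simp add: block_wreath_def)
    have "inv' k \<circ> g permutes {1..m * n}" by (rule permutes_compose[OF gp permutes_inv[OF kp]])
    moreover have "(inv' k \<circ> g) (m * n) = m * n"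
      using k(2) permutes_inverses(2)[OF kp, of "m * n"] by simp
    ultimately have "inv' k \<circ> g \<in> carrier ?S" using S_iff by (simp add: sym_group_carrier)
    moreover have "g = k \<otimes>\<^bsub>?G\<^esub> (inv' k \<circ> g)"
      by (simp add: sym_group_mult permutes_inv_o(1)[OF kp] flip: comp_assoc)
    ultimately show ?thesis using k(1) by blast
  qed
  have W': "subgroup ?W' ?L" by (rule block_wreath_subgroup[OF K])
  have W'_sub: "?W' \<subseteq> carrier ?L" "\<one>\<^bsub>?L\<^esub> \<in> ?W'"
    using subgroup.subset[OF W'] subgroup.one_closed[OF W'] by auto
  let ?M = "{h \<in> carrier H. \<pi> h \<in> ?W'}"
  have inter: "?W \<inter> carrier ?S = {p \<in> ?W. p permutes {1..m * n - 1}}"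
    by (auto simp: sym_group_carrier comm)
  have eq: "?W \<inter> carrier ?S = \<iota> ` ?M"
    unfolding inter block_wreath_point_stabilizer[OF K m n] stab ..
  have "rep_iso ?S (res_rep (carrier ?S) (ind_rep id (?G\<lparr>carrier := ?W\<rparr>) ?G triv_rep))
    (ind_rep id (?G\<lparr>carrier := ?W \<inter> carrier ?S\<rparr>) ?S triv_rep)"
    using mackey_single_double_coset[OF is_group W S_sub decomp] unfolding S[symmetric] .
  also have "ind_rep id (?G\<lparr>carrier := ?W \<inter> carrier ?S\<rparr>) ?S triv_rep
    = ind_rep \<iota> (H\<lparr>carrier := ?M\<rparr>) ?S triv_rep"
    unfolding eq by (rule ind_triv_cong) simp
  finally have 1: "rep_iso ?S (res_rep (carrier ?S) (ind_rep id (?G\<lparr>carrier := ?W\<rparr>) ?G triv_rep))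
    (ind_rep \<iota> (H\<lparr>carrier := ?M\<rparr>) ?S triv_rep)" .
  have "rep_iso ?S (ind_rep \<iota> H ?S (pull_rep \<pi> (ind_rep id (?L\<lparr>carrier := ?W'\<rparr>) ?L triv_rep)))
    (ind_rep \<iota> (H\<lparr>carrier := ?M\<rparr>) ?S triv_rep)"
    by (rule ind_stages[OF sym_group_is_group H sym_group_is_group \<iota> \<pi>[unfolded comm(2)]
          surj[unfolded comm(2)] W'_sub])
  then show ?thesis using rep_iso_trans[OF 1] rep_iso_sym by blast
qed

lemma sym_group_transitive:
  assumes "i \<in> {1..m}" shows "\<exists>\<kappa>\<in>carrier (sym_group m). \<kappa> m = i"
  using assms by (intro bexI[of _ "Transposition.transpose m i"]) (auto simp: sym_group_carrier intro: permutes_swap_id)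

text \<open>Multiplicativity holds because the two factors move disjoint sets of points and hence commute.\<close>

lemma young_product_hom:
  assumes "a \<le> N"
  shows "(\<lambda>(p, q). p \<circ> q) \<in> hom (sym_group a \<times>\<times> perm_group {a + 1..N}) (sym_group N)"
proof (rule homI)
  fix x y assume "x \<in> carrier (sym_group a \<times>\<times> perm_group {a + 1..N})"
    and "y \<in> carrier (sym_group a \<times>\<times> perm_group {a + 1..N})"
  then obtain p q p' q' where xy: "x = (p, q)" "y = (p', q')"
    and p: "p permutes {1..a}" "p' permutes {1..a}"
    and q: "q permutes {a + 1..N}" "q' permutes {a + 1..N}"
    by (auto simp: sym_group_def perm_group_def)
  have pN: "p permutes {1..N}" by (rule permutes_subset[OF p(1)]) (use assms in auto)
  have qN: "q permutes {1..N}" by (rule permutes_subset[OF q(1)]) auto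
  show "(case x of (p, q) \<Rightarrow> p \<circ> q) \<in> carrier (sym_group N)"
    using permutes_compose[OF qN pN] by (simp add: xy sym_group_carrier)
  have "q \<circ> p' = p' \<circ> q"
    by (rule permutes_disjoint_commute[OF p(2) q(1), symmetric]) auto
  then have "p \<circ> p' \<circ> (q \<circ> q') = p \<circ> q \<circ> (p' \<circ> q')" by (metis comp_assoc)
  then show "(case x \<otimes>\<^bsub>sym_group a \<times>\<times> perm_group {a + 1..N}\<^esub> y of (p, q) \<Rightarrow> p \<circ> q)
      = (case x of (p, q) \<Rightarrow> p \<circ> q) \<otimes>\<^bsub>sym_group N\<^esub> (case y of (p, q) \<Rightarrow> p \<circ> q)"
    by (simp add: xy sym_group_def perm_group_def)
qed

theorem lemma2p4:
  fixes m n :: nat and cs :: "nat list"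
  assumes "m > 0" and "n > 0"
    and "cycle cs" and "set cs = {1..m}"
  shows "rep_iso (sym_group (n * m - 1))
           (res_rep (carrier (sym_group (n * m - 1)))
              (ind_rep id (C_group m n) (sym_group (m * n)) triv_rep))
           (ind_rep (\<lambda>(p, q). p \<circ> q)
              (sym_group ((n - 1) * m) \<times>\<times> perm_group {(n - 1) * m + 1..n * m - 1})
              (sym_group (n * m - 1))
              (external_tensor
                 (ind_rep id (C_group m (n - 1)) (sym_group (m * (n - 1))) triv_rep)
                 triv_rep)) \<and>
         rep_iso (sym_group (n * m - 1))
           (res_rep (carrier (sym_group (n * m - 1)))
              (ind_rep id (D_group (cycle_of_list cs) m n) (sym_group (m * n)) triv_rep))
           (ind_rep id (sym_group ((n - 1) * m)) (sym_group (n * m - 1))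
              (ind_rep id (D_group (cycle_of_list cs) m (n - 1)) (sym_group (m * (n - 1)))
                 triv_rep))"
proof
  have le: "(n - 1) * m \<le> n * m - 1" using assms(1,2) by (cases n) auto
  have comm: "(n - 1) * m = m * (n - 1)" by simp
  let ?S = "sym_group (n * m - 1)" and ?L = "sym_group ((n - 1) * m)" and ?L' = "sym_group (m * (n - 1))"
  let ?P = "perm_group {(n - 1) * m + 1..n * m - 1}"
  let ?K = "carrier (sym_group m)"
  let ?U = "ind_rep id (C_group m (n - 1)) ?L' triv_rep"
  have K: "subgroup ?K (sym_group m)" by (rule group.subgroup_self[OF sym_group_is_group])
  have H: "group (?L \<times>\<times> ?P)" by (rule DirProd_group[OF sym_group_is_group perm_group_group])
  have \<iota>: "(\<lambda>(p, q). p \<circ> q) \<in> hom (?L \<times>\<times> ?P) ?S" by (rule young_product_hom[OF le])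
  then have \<iota>_maps: "(\<lambda>(p, q). p \<circ> q) \<in> carrier (?L \<times>\<times> ?P) \<rightarrow> carrier ?S"
    unfolding hom_def by blast
  have \<pi>: "fst \<in> hom (?L \<times>\<times> ?P) ?L" by (auto intro!: homI simp: DirProd_def)
  have surj: "fst ` carrier (?L \<times>\<times> ?P) = carrier ?L"
    using group.is_monoid[OF perm_group_group] monoid.one_closed by (fastforce simp: DirProd_def)
  have sub: "block_wreath C m (n - 1) \<subseteq> carrier ?L" for C
    unfolding comm by (auto simp: block_wreath_def sym_group_carrier)
  have last_q: "q permutes {(n - 1) * m + 1..n * m - 1}
      \<longleftrightarrow> (\<exists>\<kappa>. \<kappa> permutes {1..m} \<and> \<kappa> m = m \<and> q = last_block m n \<kappa>)" for q
    using arg_cong[OF last_block_image[OF assms(1,2)], of "\<lambda>A. q \<in> A"] by blast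
  have "(\<lambda>(p, q). p \<circ> q) ` {h \<in> carrier (?L \<times>\<times> ?P). fst h \<in> block_wreath ?K m (n - 1)}
      = {p \<circ> q | p q. p \<in> block_wreath ?K m (n - 1) \<and> q permutes {(n - 1) * m + 1..n * m - 1}}"
    using sub[of ?K] by (force simp: perm_group_def)
  also have "\<dots> = {p \<circ> last_block m n \<kappa> | p \<kappa>. p \<in> block_wreath ?K m (n - 1) \<and> \<kappa> \<in> ?K \<and> \<kappa> m = m}"
    unfolding last_q sym_group_carrier by blast
  finally have stab: "(\<lambda>(p, q). p \<circ> q) ` {h \<in> carrier (?L \<times>\<times> ?P). fst h \<in> block_wreath ?K m (n - 1)}
      = {p \<circ> last_block m n \<kappa> | p \<kappa>. p \<in> block_wreath ?K m (n - 1) \<and> \<kappa> \<in> ?K \<and> \<kappa> m = m}" .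
  have 1: "rep_iso ?S (res_rep (carrier ?S) (ind_rep id (C_group m n) (sym_group (m * n)) triv_rep))
      (ind_rep (\<lambda>(p, q). p \<circ> q) (?L \<times>\<times> ?P) ?S (pull_rep fst ?U))"
    unfolding C_group_def
    by (rule res_ind_wreath[OF assms(1,2) K sym_group_transitive H \<iota> \<pi> surj stab])
  have "representation ?L' ?U"
    by (rule ind_triv_representation[OF sym_group_is_group])
      (use sub[of ?K, unfolded comm] in \<open>auto simp: C_group_def\<close>)
  then have "rep_iso (?L \<times>\<times> ?P) (pull_rep fst ?U) (external_tensor ?U triv_rep)"
    unfolding comm by (rule external_tensor_triv[OF _ perm_group_group])
  then have "rep_iso ?S (ind_rep (\<lambda>(p, q). p \<circ> q) (?L \<times>\<times> ?P) ?S (pull_rep fst ?U))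
      (ind_rep (\<lambda>(p, q). p \<circ> q) (?L \<times>\<times> ?P) ?S (external_tensor ?U triv_rep))"
    by (rule ind_rep_iso[OF sym_group_is_group \<iota>_maps])
  with 1 show "rep_iso ?S (res_rep (carrier ?S) (ind_rep id (C_group m n) (sym_group (m * n)) triv_rep))
      (ind_rep (\<lambda>(p, q). p \<circ> q) (?L \<times>\<times> ?P) ?S (external_tensor ?U triv_rep))"
    by (rule rep_iso_trans)
  let ?D = "generate (sym_group m) {cycle_of_list cs}"
  have stabD: "id ` {h \<in> carrier ?L. id h \<in> block_wreath ?D m (n - 1)}
      = {p \<circ> last_block m n \<kappa> | p \<kappa>. p \<in> block_wreath ?D m (n - 1) \<and> \<kappa> \<in> ?D \<and> \<kappa> m = m}"
    (is "?A = ?B")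
  proof
    have one: "id \<in> ?D" by (rule sym_subgroupD(1)[OF cyclic_group_perms(1)[OF assms(3,4)]])
    show "?A \<subseteq> ?B"
    proof
      fix p assume "p \<in> ?A"
      then have "p \<in> block_wreath ?D m (n - 1)" "p = p \<circ> last_block m n id"
        by (simp_all add: last_block_id)
      with one show "p \<in> ?B" by (intro CollectI exI[of _ p] exI[of _ id]) simp
    qed
    show "?B \<subseteq> ?A"
    proof
      fix r assume "r \<in> ?B"
      then obtain p \<kappa> where "r = p \<circ> last_block m n \<kappa>" "p \<in> block_wreath ?D m (n - 1)" "\<kappa> \<in> ?D" "\<kappa> m = m"
        by blast
      moreover from this have "\<kappa> = id" using cyclic_group_free[OF assms(3,4)] by blast
      ultimately have "r \<in> block_wreath ?D m (n - 1)" by (simp add: last_block_id)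
      then show "r \<in> ?A" using sub[of ?D] by auto
    qed
  qed
  have idL: "id \<in> hom ?L ?S"
  proof (rule homI)
    show "id p \<in> carrier ?S" if "p \<in> carrier ?L" for p
      using that permutes_subset[of p "{1..(n - 1) * m}" "{1..n * m - 1}"] le
      by (simp add: sym_group_carrier)
  qed (simp add: sym_group_mult)
  have "rep_iso ?S (res_rep (carrier ?S) (ind_rep id (D_group (cycle_of_list cs) m n) (sym_group (m * n)) triv_rep))
      (ind_rep id ?L ?S (pull_rep id (ind_rep id (D_group (cycle_of_list cs) m (n - 1)) ?L' triv_rep)))"
    unfolding D_group_def
    by (rule res_ind_wreath[OF assms(1,2) cyclic_group_perms(1)[OF assms(3,4)]
          cyclic_group_transitive[OF assms(3,4)] sym_group_is_group idL _ _ stabD])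
      (auto intro: homI)
  then show "rep_iso ?S (res_rep (carrier ?S) (ind_rep id (D_group (cycle_of_list cs) m n) (sym_group (m * n)) triv_rep))
      (ind_rep id ?L ?S (ind_rep id (D_group (cycle_of_list cs) m (n - 1)) ?L' triv_rep))"
    unfolding pull_rep_id .
qed

end
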